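(* Let $T$ be a reduced tree of order $n\geq 7$. If $T$ contains no pendant path $P_3$ and each quasi-pendant vertex of $T$ has degree $2$ in $T$, then $$m_{L(T)}(1)\leq \frac{n-5}{6},$$ and equality holds if and only if $T$ is isomorphic to the following tree on $11$ vertices: take a path $u\,w\,v$ on three vertices and four disjoint copies of the path $P_2$; join $u$ by an edge to one end-vertex of each of two of these copies, and join $v$ by an edge to one end-vertex of each of the other two copies.
   Context: All graphs are finite, simple, undirected and connected. $P_k$ denotes the path on $k$ vertices. The Laplacian matrix of a graph $G$ is $L(G)=D(G)-A(G)$, where $D(G)$ is the diagonal matrix of vertex degrees and $A(G)$ is the adjacency matrix; $m_{L(G)}(1)$ denotes the multiplicity of $1$ as an eigenvalue of $L(G)$ (with value $0$ if $1$ is not an eigenvalue). The order of a graph is its number of vertices. A pendant vertex is a vertex of degree $1$; a quasi-pendant vertex is a vertex adjacent to a pendant vertex. Let $p(G)$ and $q(G)$ be the numbers of pendant and quasi-pendant vertices of $G$. The graph $G$ is called reduced if $p(G)=q(G)$, i.e. every quasi-pendant vertex is adjacent to exactly one pendant vertex. $G$ contains a pendant path $P_k$ if $G$ can be obtained from a graph $H$ and a disjoint path $P_k$ by adding an edge joining a pendant vertex (end-vertex) of $P_k$ to some vertex of $H$. *)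

theory Defs
  imports
    "Graph_Theory.Graph_Theory"
    "Jordan_Normal_Form.Char_Poly"
begin

text \<open>
  Finite simple undirected graphs are the \<open>pair_graph\<close>s of \<open>Graph_Theory\<close>: an undirected edge
  \<open>{u, v}\<close> is represented by the two arcs \<open>(u, v)\<close> and \<open>(v, u)\<close>, so the degree of a vertex is
  its out-degree.
\<close>

definition conn_graph :: "'a pair_pre_digraph \<Rightarrow> bool" where
  "conn_graph G \<longleftrightarrow> pair_graph G \<and> Digraph_Component.connected (with_proj G)"

text \<open>
  The \<open>tree\<close> of \<open>Graph_Theory\<close> excludes directed cycles, hence every symmetric digraph with an arc,
  because \<open>u, v, u\<close> counts as a cycle there.  The cycles of an undirected graph are
  the directed cycles of length at least 3 of its symmetric digraph.
\<close>

definition tree_graph :: "'a pair_pre_digraph \<Rightarrow> bool" where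
  "tree_graph G \<longleftrightarrow>
     conn_graph G \<and> \<not> (\<exists>c. pre_digraph.cycle (with_proj G) c \<and> 3 \<le> length c)"

abbreviation degree_of :: "'a pair_pre_digraph \<Rightarrow> 'a \<Rightarrow> nat" where
  "degree_of G v \<equiv> out_degree (with_proj G) v"

definition pendant_verts :: "'a pair_pre_digraph \<Rightarrow> 'a set" where
  "pendant_verts G = {v \<in> pverts G. degree_of G v = 1}"

definition quasi_pendant_verts :: "'a pair_pre_digraph \<Rightarrow> 'a set" where
  "quasi_pendant_verts G = {v \<in> pverts G. \<exists>u \<in> pendant_verts G. (v, u) \<in> parcs G}"

definition reduced :: "'a pair_pre_digraph \<Rightarrow> bool" where
  "reduced G \<longleftrightarrow> card (pendant_verts G) = card (quasi_pendant_verts G)"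

definition path_graph :: "'a list \<Rightarrow> 'a pair_pre_digraph" where
  "path_graph ps =
     \<lparr> pverts = set ps, parcs = set (zip ps (tl ps)) \<union> (set (zip ps (tl ps)))\<inverse> \<rparr>"

text \<open>
  Taking the attached end-vertex to be \<open>hd ps\<close> loses nothing, since \<open>ps\<close> may be reversed.
\<close>

definition contains_pendant_path :: "'a pair_pre_digraph \<Rightarrow> nat \<Rightarrow> bool" where
  "contains_pendant_path G k \<longleftrightarrow>
     (\<exists>H ps x. conn_graph H \<and> distinct ps \<and> length ps = k \<and> 1 \<le> k \<and>
        pverts H \<inter> set ps = {} \<and> x \<in> pverts H \<and>
        G = \<lparr> pverts = pverts H \<union> pverts (path_graph ps),
              parcs = parcs H \<union> parcs (path_graph ps) \<union> {(x, hd ps), (hd ps, x)} \<rparr>)"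

text \<open>
  The list \<open>vs\<close> is an enumeration of the vertices, fixing the order of the rows and columns.
\<close>

definition degree_mat :: "'a list \<Rightarrow> 'a pair_pre_digraph \<Rightarrow> real mat" where
  "degree_mat vs G =
     mat (length vs) (length vs) (\<lambda>(i, j). if i = j then real (degree_of G (vs ! i)) else 0)"

definition adjacency_mat :: "'a list \<Rightarrow> 'a pair_pre_digraph \<Rightarrow> real mat" where
  "adjacency_mat vs G =
     mat (length vs) (length vs) (\<lambda>(i, j). if (vs ! i, vs ! j) \<in> parcs G then 1 else 0)"

definition laplacian_mat :: "'a list \<Rightarrow> 'a pair_pre_digraph \<Rightarrow> real mat" where
  "laplacian_mat vs G = degree_mat vs G - adjacency_mat vs G"

definition eigenvalue_multiplicity :: "real mat \<Rightarrow> real \<Rightarrow> nat" where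
  "eigenvalue_multiplicity A k = Polynomial.order k (char_poly A)"

text \<open>
  The vertices \<open>u, w, v\<close> are \<open>0, 1, 2\<close>; the copies of \<open>P\<^sub>2\<close> are \<open>3-4\<close>, \<open>5-6\<close> (joined to \<open>u\<close>) and
  \<open>7-8\<close>, \<open>9-10\<close> (joined to \<open>v\<close>).
\<close>

definition extremal_tree :: "nat pair_pre_digraph" where
  "extremal_tree =
     (let E = {(0, 1), (1, 2),
               (0, 3), (3, 4), (0, 5), (5, 6),
               (2, 7), (7, 8), (2, 9), (9, 10)}
      in \<lparr> pverts = {0..10}, parcs = E \<union> E\<inverse> \<rparr>)"

end

theory Submission
  imports Defs
    "Jordan_Normal_Form.Jordan_Normal_Form_Existence"
    "Jordan_Normal_Form.Jordan_Normal_Form_Uniqueness"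
begin

text \<open>
  Let \<open>f\<close> be a solution of \<open>L f = f\<close>, seen as a function on the vertices of the tree.  The row of a
  pendant vertex says that \<open>f\<close> vanishes at its quasi-pendant neighbour \<open>q\<close>, and the row of \<open>q\<close> that the
  value at the pendant vertex is the negative of the value at the other neighbour of \<open>q\<close>.  So \<open>f\<close> is
  determined by its values on the set \<open>R\<close> of vertices that are neither pendant nor quasi-pendant, where
  \<open>(deg x - 1) * f x\<close> is the sum of \<open>f\<close> over the neighbours of \<open>x\<close> in \<open>R\<close> (lemma \<open>eig_core\<close>).  The vertices of
  \<open>R\<close> induce a tree, and since there is no pendant path \<open>P\<^sub>3\<close>, each of its ends carries at least two
  pendant paths \<open>P\<^sub>2\<close>.

  Eliminate along this tree from its ends.  On the branch hanging at \<open>v\<close> below its parent \<open>p\<close>, a solution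
  satisfies one linear relation between \<open>f p\<close> and \<open>f v\<close>, either \<open>f v = e * f p\<close> or \<open>f p = 0\<close>, and it is
  determined by these two values together with its values on a certain set \<open>Z\<close>.  A new element of \<open>Z\<close>
  is needed only where several children force the value of their parent to be zero.  Such children
  have large branches, and keeping track of how the size of a branch depends on its relation gives
  at least \<open>6 * |Z| + 5\<close> vertices for each branch (lemma \<open>branch_certificate\<close>).  At a root with at least
  two neighbours in \<open>R\<close> one obtains a set \<open>Y\<close> such that a solution vanishing on \<open>Y\<close> is zero and
  \<open>n \<ge> 6 * |Y| + 5\<close>, with equality only if the root has exactly two branches, each of them a vertex
  with two copies of \<open>P\<^sub>2\<close>: this is the tree with eleven vertices (lemmas \<open>determining_set\<close> and
  \<open>extremal_layout\<close>).

  The Laplacian matrix is real symmetric, so the multiplicity \<open>m\<close> of the root \<open>1\<close> of its characteristic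
  polynomial is the dimension of the solution space, hence at most \<open>|Y|\<close> (lemma
  \<open>order_char_poly_symmetric_le\<close>), and \<open>6 * m + 5 \<le> n\<close>.  For the tree with eleven vertices an explicit
  eigenvector shows \<open>m \<ge> 1\<close>, so that equality holds.
\<close>

section \<open>Multiplicity of eigenvalues of real symmetric matrices\<close>

lemma scalar_prod_symmetric_mat:
  fixes A :: "'a :: comm_ring_1 mat"
  assumes "A \<in> carrier_mat n n" "A\<^sup>T = A" "x \<in> carrier_vec n" "y \<in> carrier_vec n"
  shows "(A *\<^sub>v x) \<bullet> y = x \<bullet> (A *\<^sub>v y)"
  using assms by (metis transpose_vec_mult_scalar comm_scalar_prod mult_mat_vec_carrier)

text \<open>
  If \<open>B\<close> kills \<open>y = B z\<close>, then \<open>\<langle>y, y\<rangle> = \<langle>B z, y\<rangle> = \<langle>z, B y\<rangle> = 0\<close>, so \<open>y = 0\<close>: a Hermitian matrix has no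
  generalized eigenvectors beyond its eigenvectors.  The matrix is a real symmetric one regarded as
  complex, so being Hermitian is stated as symmetry together with commutation with conjugation.
\<close>

lemma kernel_pow_real_symmetric:
  fixes B :: "complex mat"
  assumes B: "B \<in> carrier_mat n n" and sym: "B\<^sup>T = B"
    and real: "\<And>x. x \<in> carrier_vec n \<Longrightarrow> conjugate (B *\<^sub>v x) = B *\<^sub>v conjugate x"
  shows "mat_kernel (B ^\<^sub>m Suc k) = mat_kernel B"
proof (induction k)
  case 0
  then show ?case using B by simp
next
  case (Suc k)
  have Bk: "B ^\<^sub>m k \<in> carrier_mat n n" "B ^\<^sub>m Suc k \<in> carrier_mat n n" "B ^\<^sub>m Suc (Suc k) \<in> carrier_mat n n"
    using B by (auto intro!: pow_carrier_mat)
  have pows: "B ^\<^sub>m Suc j = B * B ^\<^sub>m j" for j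
  proof (induction j)
    case (Suc j)
    have "B ^\<^sub>m Suc (Suc j) = B * B ^\<^sub>m j * B"
      using Suc by simp
    also have "\<dots> = B * (B ^\<^sub>m j * B)"
      using B by (intro assoc_mult_mat) (auto intro!: pow_carrier_mat)
    finally show ?case by simp
  qed (use B in auto)
  have "mat_kernel (B ^\<^sub>m Suc (Suc k)) = mat_kernel (B ^\<^sub>m Suc k)"
  proof (intro equalityI subsetI)
    fix x assume "x \<in> mat_kernel (B ^\<^sub>m Suc (Suc k))"
    then have x: "x \<in> carrier_vec n" and 0: "B ^\<^sub>m Suc (Suc k) *\<^sub>v x = 0\<^sub>v n"
      using mat_kernelD[OF Bk(3)] by auto
    define z where "z = B ^\<^sub>m k *\<^sub>v x"
    define y where "y = B *\<^sub>v z"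
    have z: "z \<in> carrier_vec n" and y: "y \<in> carrier_vec n"
      unfolding y_def z_def by (rule mult_mat_vec_carrier[OF Bk(1) x],
        rule mult_mat_vec_carrier[OF B mult_mat_vec_carrier[OF Bk(1) x]])
    have yk: "B ^\<^sub>m Suc k *\<^sub>v x = y"
      unfolding pows[of k] y_def z_def by (rule assoc_mult_mat_vec[OF B Bk(1) x])
    have By: "B *\<^sub>v y = 0\<^sub>v n"
      using 0 unfolding pows[of "Suc k"] assoc_mult_mat_vec[OF B Bk(2) x] yk .
    have "conjugate y \<bullet> y = (B *\<^sub>v conjugate z) \<bullet> y"
      unfolding y_def using real[OF z] by simp
    also have "\<dots> = conjugate z \<bullet> (B *\<^sub>v y)"
      using z y by (intro scalar_prod_symmetric_mat[OF B sym]) auto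
    also have "\<dots> = 0" using z By by simp
    finally have "y \<bullet>c y = 0"
      using y by (metis comm_scalar_prod carrier_vec_conjugate)
    then have "y = 0\<^sub>v n" using y by simp
    then show "x \<in> mat_kernel (B ^\<^sub>m Suc k)"
      using yk by (intro mat_kernelI[OF Bk(2) x]) simp
  next
    fix x assume "x \<in> mat_kernel (B ^\<^sub>m Suc k)"
    then have x: "x \<in> carrier_vec n" and 0: "B ^\<^sub>m Suc k *\<^sub>v x = 0\<^sub>v n"
      using mat_kernelD[OF Bk(2)] by auto
    have "B ^\<^sub>m Suc (Suc k) *\<^sub>v x = B *\<^sub>v (B ^\<^sub>m Suc k *\<^sub>v x)"
      unfolding pows[of "Suc k"] by (rule assoc_mult_mat_vec[OF B Bk(2) x])
    then show "x \<in> mat_kernel (B ^\<^sub>m Suc (Suc k))"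
      using 0 B by (intro mat_kernelI[OF Bk(3) x]) auto
  qed
  with Suc show ?case by simp
qed

lemma kernel_dim_cong:
  assumes "mat_kernel A = mat_kernel B" "dim_col A = dim_col B"
  shows "kernel_dim A = kernel_dim B"
  unfolding kernel_dim_def using assms by simp

text \<open>
  The coordinates in \<open>Z\<close> separate the points of the kernel.  If the kernel had a basis of more than
  \<open>card Z\<close> vectors, some nontrivial combination of it would vanish on \<open>Z\<close>.  The coefficients of
  such a combination are found in the kernel of a singular square matrix: the rows indexed by \<open>Z\<close> of
  the matrix of basis vectors, padded with zero rows.
\<close>

lemma kernel_dim_le_card:
  fixes B :: "'a :: field mat"
  assumes B: "B \<in> carrier_mat n n" and Z: "finite Z" "Z \<subseteq> {..<n}"
    and det: "\<And>x. x \<in> mat_kernel B \<Longrightarrow> (\<forall>i\<in>Z. x $ i = 0) \<Longrightarrow> x = 0\<^sub>v n"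
  shows "kernel_dim B \<le> card Z"
proof (rule ccontr)
  assume "\<not> ?thesis"
  then have less: "card Z < kernel_dim B" by simp
  interpret K: kernel n n B by unfold_locales (rule B)
  obtain bb where bb: "finite bb" "K.Ker.basis bb"
    using kernel_basis_exists[OF B] by blast
  define m where "m = kernel_dim B"
  have card_bb: "card bb = m"
    unfolding m_def K.kernel_dim using K.Ker.dim_basis[OF bb] by simp
  have bb_ker: "bb \<subseteq> mat_kernel B" and indep: "K.Ker.lin_indpt bb"
    using bb(2) unfolding K.Ker.basis_def by auto
  obtain bs where bs: "distinct bs" "set bs = bb" using bb(1) finite_distinct_list by blast
  have len: "length bs = m" using bs card_bb distinct_card by metis
  obtain zs where zs: "distinct zs" "set zs = Z" using Z(1) finite_distinct_list by blast
  have lenz: "length zs = card Z" using zs distinct_card by metis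
  define M where "M = mat m m (\<lambda>(i,j). if i < card Z then bs ! j $ (zs ! i) else 0)"
  have M: "M \<in> carrier_mat m m" unfolding M_def by simp
  have "m - 1 < m" "card Z \<le> m - 1" using less m_def by auto
  then have "M = mat\<^sub>r m m (\<lambda>i. if i = m - 1 then 0\<^sub>v m else row M i)"
    by (intro eq_matI) (auto simp: M_def)
  then have "det M = 0" using det_row_0[OF \<open>m - 1 < m\<close>, of "row M"] M by auto
  then obtain c where c: "c \<in> carrier_vec m" "c \<noteq> 0\<^sub>v m" "M *\<^sub>v c = 0\<^sub>v m"
    using det_0_iff_vec_prod_zero[OF M] by blast
  define a where "a b = c $ (THE j. j < m \<and> bs ! j = b)" for b
  have a: "a (bs ! j) = c $ j" if "j < m" for j
  proof -
    have "(THE j'. j' < m \<and> bs ! j' = bs ! j) = j"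
      using that bs(1) len by (intro the_equality) (auto simp: nth_eq_iff_index_eq)
    then show ?thesis unfolding a_def by simp
  qed
  define w where "w = K.lincomb a bb"
  have w_ker: "w \<in> mat_kernel B"
    unfolding w_def using bb_ker by (intro K.Ker.lincomb_closed) auto
  have "w $ (zs ! i) = 0" if i: "i < card Z" for i
  proof -
    have zi: "zs ! i < n" using i zs lenz Z(2) nth_mem by fastforce
    have "w $ (zs ! i) = (\<Sum>x\<in>set bs. a x * x $ (zs ! i))"
      unfolding w_def bs(2) by (rule K.lincomb_index[OF zi bb_ker])
    also have "\<dots> = (\<Sum>j<m. a (bs ! j) * bs ! j $ (zs ! i))"
      using bs len by (intro sum.reindex_bij_betw[symmetric] bij_betw_nth) auto
    also have "\<dots> = (\<Sum>j<m. M $$ (i,j) * c $ j)"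
      using i less by (intro sum.cong) (auto simp: a M_def m_def)
    also have "\<dots> = (M *\<^sub>v c) $ i"
      using i less M c(1) unfolding m_def
      by (auto simp: scalar_prod_def atLeast0LessThan intro!: sum.cong)
    also have "\<dots> = 0" using c i less m_def by simp
    finally show ?thesis .
  qed
  then have "\<forall>i\<in>Z. w $ i = 0" using zs lenz by (metis in_set_conv_nth)
  with det w_ker have w0: "w = 0\<^sub>v n" by blast
  have "a \<in> bb \<rightarrow> {0}"
    using K.Ker.not_lindepD[OF indep bb(1) order_refl, of a] w0
    by (simp add: w_def)
  then have "c $ j = 0" if "j < m" for j
    using a that bs len by (metis Pi_iff nth_mem singletonD)
  then have "c = 0\<^sub>v m" using c(1) by (intro eq_vecI) auto
  with c(2) show False by simp
qed

text \<open>
  The order of the root is the sum of the sizes of the Jordan blocks of \<open>k\<close>, which is the dimension of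
  the generalized eigenspace for any exponent that exceeds all these sizes.
\<close>

lemma order_char_poly_eq_kernel_dim:
  fixes A :: "complex mat"
  assumes A: "A \<in> carrier_mat n n"
    and stable: "\<And>j. mat_kernel (char_matrix A k ^\<^sub>m Suc j) = mat_kernel (char_matrix A k)"
  shows "Polynomial.order k (char_poly A) = kernel_dim (char_matrix A k)"
proof -
  obtain as where "char_poly A = (\<Prod>a\<leftarrow>as. [:- a, 1:])"
    using char_poly_factorized[OF A] by blast
  then obtain n_as where jnf: "jordan_nf A n_as" using jordan_nf_exists[OF A] by blast
  define ns where "ns = map fst (filter (\<lambda>na. snd na = k) n_as)"
  define N where "N = sum_list ns"
  have "Polynomial.order k (char_poly A) = N"
    unfolding N_def ns_def by (rule jordan_nf_order[OF jnf])
  also have "N = (\<Sum>n \<leftarrow> ns. min (Suc N) n)"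
  proof -
    have "n \<le> N" if "n \<in> set ns" for n unfolding N_def using that by (intro member_le_sum_list) auto
    then have "map (min (Suc N)) ns = ns" by (intro map_idI min_absorb2) (rule le_SucI)
    then show ?thesis unfolding N_def by simp
  qed
  also have "\<dots> = dim_gen_eigenspace A k (Suc N)"
    unfolding dim_gen_eigenspace[OF jnf] ns_def by (simp add: case_prod_beta' split_def)
  also have "\<dots> = kernel_dim (char_matrix A k)"
    unfolding dim_gen_eigenspace_def using stable[of N] A
    by (intro kernel_dim_cong) auto
  finally show ?thesis .
qed

text \<open>
  The Jordan form lives over the complex numbers; the hypothesis speaks of real vectors, and applies to
  the real and imaginary parts of a complex eigenvector.
\<close>

lemma order_char_poly_symmetric_le:
  fixes A :: "real mat"
  assumes A: "A \<in> carrier_mat n n" and sym: "A\<^sup>T = A" and Z: "Z \<subseteq> {..<n}"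
    and det: "\<And>x. x \<in> carrier_vec n \<Longrightarrow> A *\<^sub>v x = k \<cdot>\<^sub>v x \<Longrightarrow> (\<forall>i\<in>Z. x $ i = 0) \<Longrightarrow> x = 0\<^sub>v n"
  shows "Polynomial.order k (char_poly A) \<le> card Z"
proof -
  define C where "C = map_mat complex_of_real A"
  define B where "B = char_matrix C (complex_of_real k)"
  have C: "C \<in> carrier_mat n n" using A by (simp add: C_def)
  have B: "B \<in> carrier_mat n n" using C by (simp add: B_def)
  have Bij: "B $$ (i,j) = complex_of_real (A $$ (i,j) - (if i = j then k else 0))" if "i < n" "j < n" for i j
    using that A unfolding B_def C_def char_matrix_def by auto
  have Aij: "A $$ (i,j) = A $$ (j,i)" if "i < n" "j < n" for i j
    using that A sym by (metis carrier_matD index_transpose_mat(1))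
  have symB: "B\<^sup>T = B" using B by (intro eq_matI) (auto simp: Bij Aij)
  have Bx: "(B *\<^sub>v x) $ i = (\<Sum>j<n. complex_of_real (A $$ (i,j)) * x $ j) - complex_of_real k * x $ i"
    if "x \<in> carrier_vec n" "i < n" for x i
  proof -
    have "(B *\<^sub>v x) $ i = (\<Sum>j<n. complex_of_real (A $$ (i,j)) * x $ j - (if i = j then complex_of_real k * x $ j else 0))"
      using that B by (auto simp: scalar_prod_def atLeast0LessThan Bij algebra_simps intro!: sum.cong)
    then show ?thesis using that by (simp add: sum_subtractf)
  qed
  have realB: "conjugate (B *\<^sub>v x) = B *\<^sub>v conjugate x" if "x \<in> carrier_vec n" for x
  proof (rule eq_vecI)
    show "dim_vec (conjugate (B *\<^sub>v x)) = dim_vec (B *\<^sub>v conjugate x)" using B by simp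
    fix i assume "i < dim_vec (B *\<^sub>v conjugate x)"
    then have i: "i < n" using B by simp
    have cx: "conjugate x \<in> carrier_vec n" using that by simp
    have "conjugate (B *\<^sub>v x) $ i = cnj ((B *\<^sub>v x) $ i)" using i B by simp
    also have "\<dots> = (B *\<^sub>v conjugate x) $ i"
      unfolding Bx[OF that i] Bx[OF cx i] using that i by auto
    finally show "conjugate (B *\<^sub>v x) $ i = (B *\<^sub>v conjugate x) $ i" .
  qed
  interpret h: map_poly_inj_idom_divide_hom complex_of_real ..
  have "Polynomial.order k (char_poly A) = Polynomial.order (complex_of_real k) (char_poly C)"
    unfolding C_def of_real_hom.char_poly_hom[OF A] by (simp add: h.order_hom)
  also have "\<dots> = kernel_dim B"
    unfolding B_def
    by (rule order_char_poly_eq_kernel_dim[OF C])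
       (use kernel_pow_real_symmetric[OF B symB realB] in \<open>simp add: B_def\<close>)
  also have "\<dots> \<le> card Z"
  proof (rule kernel_dim_le_card[OF B finite_subset[OF Z] Z])
    fix x assume xk: "x \<in> mat_kernel B" and xZ: "\<forall>i\<in>Z. x $ i = 0"
    have x: "x \<in> carrier_vec n" and Bx0: "B *\<^sub>v x = 0\<^sub>v n" using mat_kernelD[OF B xk] by auto
    have eq: "(\<Sum>j<n. complex_of_real (A $$ (i,j)) * x $ j) = complex_of_real k * x $ i" if "i < n" for i
      using Bx[OF x that] Bx0 that by simp
    have part: "map_vec h x = 0\<^sub>v n" if h: "h = Re \<or> h = Im" for h
    proof (rule det)
      show "map_vec h x \<in> carrier_vec n" using x by simp
      show "\<forall>i\<in>Z. map_vec h x $ i = 0" using xZ Z x h by auto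
      show "A *\<^sub>v map_vec h x = k \<cdot>\<^sub>v map_vec h x"
      proof (rule eq_vecI)
        fix i assume "i < dim_vec (k \<cdot>\<^sub>v map_vec h x)"
        then have i: "i < n" using x by simp
        have "(A *\<^sub>v map_vec h x) $ i = (\<Sum>j<n. A $$ (i,j) * h (x $ j))"
          using i A x by (auto simp: scalar_prod_def atLeast0LessThan intro!: sum.cong)
        also have "\<dots> = h (\<Sum>j<n. complex_of_real (A $$ (i,j)) * x $ j)"
          using h by auto
        also have "\<dots> = k * h (x $ i)" using eq[OF i] h by auto
        finally show "(A *\<^sub>v map_vec h x) $ i = (k \<cdot>\<^sub>v map_vec h x) $ i" using i x by simp
      qed (use A x in simp)
    qed
    show "x = 0\<^sub>v n"
    proof (rule eq_vecI)
      fix i assume "i < dim_vec (0\<^sub>v n :: complex vec)"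
      then have i: "i < n" by simp
      have "Re (x $ i) = 0" "Im (x $ i) = 0"
        using arg_cong[OF part[of Re], of "\<lambda>v. v $ i"] arg_cong[OF part[of Im], of "\<lambda>v. v $ i"] i x by auto
      then show "x $ i = 0\<^sub>v n $ i" using i by (simp add: complex_eq_iff)
    qed (use x in simp)
  qed simp
  finally show ?thesis .
qed

section \<open>Branches of trees\<close>

text \<open>
  Acyclicity is stated in the form that makes the branches hanging at a vertex disjoint.
\<close>

locale finite_tree =
  fixes V :: "'a set" and E :: "'a rel"
  assumes finite_V: "finite V" and E_sub: "E \<subseteq> V \<times> V"
    and sym_E: "sym E" and irrefl_E: "irrefl E"
    and conn: "\<And>u v. u \<in> V \<Longrightarrow> v \<in> V \<Longrightarrow> (u, v) \<in> E\<^sup>*"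
    and acyclic: "\<And>v c c'. (v, c) \<in> E \<Longrightarrow> (v, c') \<in> E \<Longrightarrow>
      (c, c') \<in> {(a, b) \<in> E. a \<noteq> v \<and> b \<noteq> v}\<^sup>* \<Longrightarrow> c = c'"
begin

definition avoid :: "'a \<Rightarrow> 'a rel" where
  "avoid v = {(a, b) \<in> E. a \<noteq> v \<and> b \<noteq> v}"

abbreviation nbrs :: "'a \<Rightarrow> 'a set" where
  "nbrs v \<equiv> E `` {v}"

text \<open>
  For an edge between \<open>p\<close> and \<open>v\<close>, this is the component of \<open>v\<close> that remains when \<open>p\<close> is deleted.
\<close>

definition branch :: "'a \<Rightarrow> 'a \<Rightarrow> 'a set" where
  "branch p v = {x. (v, x) \<in> (avoid p)\<^sup>*}"

lemma edge_sym: "(a, b) \<in> E \<Longrightarrow> (b, a) \<in> E"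
  using sym_E by (rule symD)

lemma edge_neq: "(a, b) \<in> E \<Longrightarrow> a \<noteq> b"
  using irrefl_E by (auto simp: irrefl_def)

lemma edge_in_V: "(a, b) \<in> E \<Longrightarrow> a \<in> V" "(a, b) \<in> E \<Longrightarrow> b \<in> V"
  using E_sub by auto

lemma finite_nbrs [simp]: "finite (nbrs v)"
  by (rule finite_subset[OF _ finite_V]) (auto dest: edge_in_V)

lemma sym_avoid_rtrancl: "(a, b) \<in> (avoid v)\<^sup>* \<Longrightarrow> (b, a) \<in> (avoid v)\<^sup>*"
  by (rule symD[OF sym_rtrancl]) (auto intro!: symI simp: avoid_def dest: edge_sym)

lemma branch_self [simp]: "v \<in> branch p v"
  by (simp add: branch_def)

lemma branch_step:
  "x \<in> branch p v \<Longrightarrow> (x, y) \<in> E \<Longrightarrow> x \<noteq> p \<Longrightarrow> y \<noteq> p \<Longrightarrow> y \<in> branch p v"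
  unfolding branch_def by (auto simp: avoid_def intro: rtrancl_into_rtrancl)

lemma root_notin_branch: 
  assumes "(p, v) \<in> E" "x \<in> branch p v" shows "x \<noteq> p"
proof -
  have "(v, x) \<in> (avoid p)\<^sup>*" using assms(2) by (simp add: branch_def)
  then show ?thesis using edge_neq[OF assms(1)]
    by (induction rule: rtrancl_induct) (auto simp: avoid_def)
qed

lemma branch_in_V:
  assumes "v \<in> V" shows "branch p v \<subseteq> V"
proof
  fix x assume "x \<in> branch p v"
  then have "(v, x) \<in> (avoid p)\<^sup>*" by (simp add: branch_def)
  then show "x \<in> V" using assms
    by (induction rule: rtrancl_induct) (auto simp: avoid_def dest: edge_in_V)
qed

lemma finite_branch: "v \<in> V \<Longrightarrow> finite (branch p v)"
  using branch_in_V finite_V finite_subset by blast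

lemma branch_disjoint:
  assumes "(v, c) \<in> E" "(v, c') \<in> E" "c \<noteq> c'"
  shows "branch v c \<inter> branch v c' = {}"
proof (rule ccontr)
  assume "\<not> ?thesis"
  then obtain x where "(c, x) \<in> (avoid v)\<^sup>*" "(c', x) \<in> (avoid v)\<^sup>*"
    by (auto simp: branch_def)
  then have "(c, c') \<in> (avoid v)\<^sup>*"
    using sym_avoid_rtrancl rtrancl_trans by metis
  then show False using acyclic[OF assms(1,2)] assms(3) by (simp add: avoid_def)
qed

lemma parent_notin_branch:
  assumes "(p, v) \<in> E" "(v, c) \<in> E" "c \<noteq> p"
  shows "p \<notin> branch v c"
  using branch_disjoint[OF assms(2) edge_sym[OF assms(1)] assms(3)] by auto

lemma branch_decomp:
  assumes pv: "(p, v) \<in> E"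
  shows "branch p v = insert v (\<Union>c\<in>nbrs v - {p}. branch v c)"
proof (intro equalityI subsetI)
  fix x assume "x \<in> branch p v"
  then have "(v, x) \<in> (avoid p)\<^sup>*" by (simp add: branch_def)
  then show "x \<in> insert v (\<Union>c\<in>nbrs v - {p}. branch v c)"
  proof (induction rule: rtrancl_induct)
    case (step x y)
    then have xy: "(x, y) \<in> E" "x \<noteq> p" "y \<noteq> p" by (auto simp: avoid_def)
    show ?case
    proof (cases "y = v \<or> x = v")
      case True
      then show ?thesis using xy branch_self[of y v] by blast
    next
      case False
      then show ?thesis using step.IH xy branch_step[of x v _ y] by blast
    qed
  qed simp
next
  fix x assume "x \<in> insert v (\<Union>c\<in>nbrs v - {p}. branch v c)"
  then consider "x = v" | c where "(v, c) \<in> E" "c \<noteq> p" "x \<in> branch v c" by auto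
  then show "x \<in> branch p v"
  proof cases
    case 2
    have "(c, x) \<in> (avoid v)\<^sup>*" using 2 by (simp add: branch_def)
    then show ?thesis
    proof (induction rule: rtrancl_induct)
      case base
      show ?case by (rule branch_step[OF branch_self 2(1) edge_neq[OF pv, symmetric] 2(2)])
    next
      case (step y z)
      have "y \<in> branch v c" "z \<in> branch v c"
        using step.hyps by (auto simp: branch_def)
      then have "y \<noteq> p" "z \<noteq> p" using parent_notin_branch[OF pv 2(1,2)] by auto
      then show ?case using step by (intro branch_step[of y p v z]) (auto simp: avoid_def)
    qed
  qed simp
qed

lemma V_decomp:
  assumes "r \<in> V"
  shows "V = insert r (\<Union>c\<in>nbrs r. branch r c)"
proof (intro equalityI subsetI)
  fix x assume "x \<in> V"
  then have "(r, x) \<in> E\<^sup>*" using conn assms by simp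
  then show "x \<in> insert r (\<Union>c\<in>nbrs r. branch r c)"
  proof (induction rule: rtrancl_induct)
    case (step x y)
    show ?case
    proof (cases "y = r \<or> x = r")
      case True
      then show ?thesis using step.hyps branch_self[of y r] by blast
    next
      case False
      then show ?thesis using step branch_step[of x r _ y] by blast
    qed
  qed simp
qed (use assms branch_in_V edge_in_V in blast)

lemma card_insert_branches:
  assumes "C \<subseteq> nbrs v"
  shows "card (insert v (\<Union>c\<in>C. branch v c)) = 1 + (\<Sum>c\<in>C. card (branch v c))"
proof -
  have fin: "finite (branch v c)" if "c \<in> C" for c
    using that assms by (intro finite_branch) (auto dest: edge_in_V)
  have finC: "finite C" by (rule finite_subset[OF assms finite_nbrs])
  have "v \<notin> (\<Union>c\<in>C. branch v c)" using assms root_notin_branch by blast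
  then have "card (insert v (\<Union>c\<in>C. branch v c)) = 1 + card (\<Union>c\<in>C. branch v c)"
    using fin finC by simp
  also have "card (\<Union>c\<in>C. branch v c) = (\<Sum>c\<in>C. card (branch v c))"
    using fin finC assms branch_disjoint by (intro card_UN_disjoint) blast+
  finally show ?thesis .
qed

lemma child_branch_psubset:
  assumes "(p, v) \<in> E" "(v, c) \<in> E" "c \<noteq> p"
  shows "branch v c \<subset> branch p v"
  using branch_decomp[OF assms(1)] assms root_notin_branch[OF assms(2)] branch_self[of v p] by blast

lemma pendant_path_nbrs:
  assumes "(v, q) \<in> E" "(q, l) \<in> E" "l \<noteq> v" and q: "card (nbrs q) = 2" and l: "card (nbrs l) = 1"
  shows "nbrs q = {v, l}" "nbrs l = {q}"
proof -
  show "nbrs q = {v, l}"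
    using card_seteq[of "nbrs q" "{v, l}"] assms edge_sym[OF assms(1)] by auto
  obtain y where "nbrs l = {y}" using l by (auto simp: card_1_singleton_iff)
  then show "nbrs l = {q}" using edge_sym[OF assms(2)] by auto
qed

end

section \<open>Eigenvectors on branches\<close>

text \<open>
  A branch \<open>branch p v\<close> imposes on an eigenvector \<open>f\<close> one linear relation between \<open>f p\<close> and \<open>f v\<close>:
  \<open>Some e\<close> stands for \<open>f v = e * f p\<close> and \<open>None\<close> for \<open>f p = 0\<close>, the relation of infinite ratio.  If \<open>z\<close>
  further values have to be prescribed in the branch, then it has at least \<open>6 * z + excess r\<close>
  vertices, where \<open>r\<close> is the relation.  The ratios with a large excess are those that lead up the
  tree to \<open>None\<close>, the relation from which further values to prescribe arise: a vertex whose only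
  neighbour in the branch is \<open>c\<close> maps the ratio \<open>e\<close> of \<open>c\<close> to \<open>1 / (1 - e)\<close>, so \<open>0\<close> goes to \<open>1\<close> and
  \<open>1\<close> to \<open>None\<close>.  The smallest branch is one vertex carrying two paths \<open>P\<^sub>2\<close>; it has five vertices and
  ratio \<open>1/2\<close>, whence the excess \<open>5\<close> of this ratio.
\<close>

definition excess :: "real option \<Rightarrow> nat" where
  "excess r = (case r of None \<Rightarrow> 9 | Some e \<Rightarrow> if e = 0 then 10 else if e = 1 then 8 else if e = 1/2 then 5 else 6)"

lemma excess_bounds: "5 \<le> excess r" "excess r \<le> 10"
  by (auto simp: excess_def split: option.split)

text \<open>
  A vertex with \<open>a\<close> pendant paths \<open>P\<^sub>2\<close> and children of ratios \<open>e c\<close> gets the ratio \<open>1 / D\<close>.  Two children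
  already contribute \<open>10\<close>, the largest excess, and so do one child and \<open>a \<ge> 2\<close>; only a single child with
  \<open>a \<le> 1\<close> needs the finer values.  There \<open>D = 0\<close> means \<open>e = 1\<close> or \<open>e = 2\<close>, and \<open>D = 1\<close> means \<open>e = a\<close>.
\<close>

lemma excess_step:
  fixes e :: "'b \<Rightarrow> real" and a :: nat
  assumes "finite C" "C \<noteq> {}"
  defines "D \<equiv> real a + (\<Sum>c\<in>C. 1 - e c)"
  defines "r \<equiv> (if D = 0 then None else Some (1 / D))"
  shows "max 6 (excess r) \<le> 1 + 2 * a + (\<Sum>c\<in>C. excess (Some (e c)))"
proof -
  have five: "5 * card C \<le> (\<Sum>c\<in>C. excess (Some (e c)))"
    using sum_mono[of C "\<lambda>_. 5" "\<lambda>c. excess (Some (e c))"] excess_bounds by simp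
  have "card C \<noteq> 0" using assms by simp
  then consider "card C \<ge> 2" | "card C = 1" by linarith
  then show ?thesis
  proof cases
    case 1
    then show ?thesis using five excess_bounds(2)[of r] by linarith
  next
    case 2
    then obtain c where C: "C = {c}" by (auto simp: card_1_singleton_iff)
    have D: "D = real a + 1 - e c" by (simp add: D_def C)
    consider "a = 0" | "a = 1" | "a \<ge> 2" by linarith
    then show ?thesis
    proof cases
      case 3
      then show ?thesis using five excess_bounds(2)[of r] 2 by linarith
    qed (auto simp: C D r_def excess_def field_simps)
  qed
qed

text \<open>
  The sets \<open>P\<close>, \<open>Q\<close> and \<open>R\<close> are the pendant vertices, the quasi-pendant vertices and the rest.  A
  quasi-pendant neighbour of a vertex of \<open>R\<close> and its pendant vertex form a pendant path \<open>P\<^sub>2\<close>, called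
  an arm below.  A vertex of \<open>R\<close> of degree two with an arm
  would be the start of a pendant path \<open>P\<^sub>3\<close>, which is the reason for the bound \<open>R_deg\<close>.
\<close>

locale short_arm_tree = finite_tree +
  fixes P Q R :: "'a set"
  assumes P_def: "P = {v \<in> V. card (nbrs v) = 1}"
    and Q_def: "Q = {v \<in> V. \<exists>u \<in> P. (v, u) \<in> E}"
    and R_def: "R = V - P - Q"
    and Q_deg: "\<And>q. q \<in> Q \<Longrightarrow> card (nbrs q) = 2"
    and R_deg: "\<And>v q. v \<in> R \<Longrightarrow> (v, q) \<in> E \<Longrightarrow> q \<in> Q \<Longrightarrow> 3 \<le> card (nbrs v)"
begin

text \<open>
  The row of \<open>x\<close> of the equation \<open>L f = f\<close> for the Laplacian matrix \<open>L\<close>.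
\<close>

definition eig :: "('a \<Rightarrow> real) \<Rightarrow> 'a \<Rightarrow> bool" where
  "eig f x \<longleftrightarrow> real (card (nbrs x)) * f x - (\<Sum>u\<in>nbrs x. f u) = f x"

definition arms :: "'a \<Rightarrow> 'a set" where
  "arms v = nbrs v \<inter> Q"

definition core :: "'a \<Rightarrow> 'a set" where
  "core v = nbrs v \<inter> R"

lemma R_in_V: "v \<in> R \<Longrightarrow> v \<in> V"
  by (simp add: R_def)

lemma nbrs_R: assumes "v \<in> R" shows "nbrs v = arms v \<union> core v" "arms v \<inter> core v = {}"
  using assms edge_in_V(2)[of v] unfolding arms_def core_def by (auto simp: R_def Q_def)

lemma finite_arms [simp]: "finite (arms v)" and finite_core [simp]: "finite (core v)"
  by (auto simp: arms_def core_def)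

lemma card_nbrs_R: "v \<in> R \<Longrightarrow> card (nbrs v) = card (arms v) + card (core v)"
  by (simp add: nbrs_R card_Un_disjoint)

lemma arm_leaf:
  assumes v: "v \<in> R" and q: "q \<in> arms v"
  obtains l where "l \<noteq> v" "q \<noteq> l" "nbrs q = {v, l}" "nbrs l = {q}" "branch v q = {q, l}"
proof -
  have vq: "(v, q) \<in> E" and qQ: "q \<in> Q" using q by (auto simp: arms_def)
  obtain l where l: "l \<in> P" "(q, l) \<in> E" using qQ by (auto simp: Q_def)
  have lv: "l \<noteq> v" using l(1) v by (auto simp: R_def)
  have Nq: "nbrs q = {v, l}" and Nl: "nbrs l = {q}"
    using pendant_path_nbrs[OF vq l(2) lv Q_deg[OF qQ]] l(1) by (auto simp: P_def)
  have "branch v q = insert q (\<Union>c\<in>{l}. branch q c)"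
    using branch_decomp[OF vq] Nq lv by (simp add: insert_Diff_if)
  moreover have "branch q l = {l}" using branch_decomp[OF l(2)] Nl by simp
  ultimately have "branch v q = {q, l}" by simp
  then show ?thesis using that[OF lv edge_neq[OF l(2)] Nq Nl] by blast
qed

lemma card_arm: "v \<in> R \<Longrightarrow> q \<in> arms v \<Longrightarrow> card (branch v q) = 2"
  by (erule (1) arm_leaf) simp

text \<open>
  The row of the pendant vertex gives \<open>f q = 0\<close>, and then the row of \<open>q\<close> gives the value \<open>- f v\<close> at the
  pendant vertex.
\<close>

lemma arm_eig:
  assumes v: "v \<in> R" and q: "q \<in> arms v" and f: "\<And>x. x \<in> branch v q \<Longrightarrow> eig f x"
  shows "f q = 0" "f v = 0 \<Longrightarrow> x \<in> branch v q \<Longrightarrow> f x = 0"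
proof -
  obtain l where l: "l \<noteq> v" "q \<noteq> l" "nbrs q = {v, l}" "nbrs l = {q}" "branch v q = {q, l}"
    using arm_leaf[OF v q] by metis
  have "eig f q" "eig f l" using f l(5) by auto
  then have "f q = 0 \<and> f q = f v + f l" using l by (auto simp: eig_def)
  then show "f q = 0" "f v = 0 \<Longrightarrow> x \<in> branch v q \<Longrightarrow> f x = 0" using l(5) by auto
qed

lemma core_edge: "u \<in> core v \<Longrightarrow> (v, u) \<in> E" "u \<in> core v \<Longrightarrow> u \<in> R"
  by (auto simp: core_def)

lemma core_sym: "v \<in> R \<Longrightarrow> u \<in> core v \<Longrightarrow> v \<in> core u"
  by (auto simp: core_def dest: edge_sym)

text \<open>
  As eigenvectors vanish at quasi-pendant vertices, the equation restricts to \<open>R\<close>, where an arm at \<open>v\<close>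
  is visible only through the degree of \<open>v\<close>.
\<close>

lemma eig_core:
  assumes v: "v \<in> R" and "eig f v" and f: "\<And>q x. q \<in> arms v \<Longrightarrow> x \<in> branch v q \<Longrightarrow> eig f x"
  shows "(\<Sum>u\<in>core v. f u) = (real (card (arms v)) + real (card (core v)) - 1) * f v"
proof -
  have "(\<Sum>u\<in>nbrs v. f u) = (\<Sum>u\<in>arms v. f u) + (\<Sum>u\<in>core v. f u)"
    unfolding nbrs_R(1)[OF v] by (rule sum.union_disjoint) (use nbrs_R[OF v] in auto)
  also have "(\<Sum>u\<in>arms v. f u) = 0" using arm_eig(1)[OF v] f by (intro sum.neutral) blast
  finally show ?thesis using assms(2) card_nbrs_R[OF v] by (simp add: eig_def algebra_simps)
qed

text \<open>
  The ends of the tree induced on \<open>R\<close> carry at least two arms; this is where the bound on degrees enters.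
\<close>

lemma arms_ge_2:
  assumes r: "r \<in> R" and core: "core r = {p}"
  shows "2 \<le> card (arms r)"
proof -
  have "card (nbrs r) \<noteq> 1" using r by (auto simp: R_def P_def)
  then have "card (arms r) \<noteq> 0" using card_nbrs_R[OF r] core by simp
  then obtain q where "q \<in> arms r" by fastforce
  then have "3 \<le> card (nbrs r)" using R_deg[OF r] by (auto simp: arms_def)
  then show ?thesis using card_nbrs_R[OF r] core by simp
qed

text \<open>
  By linearity, the last clause says that on the branch an eigenvector is determined by its values at
  \<open>p\<close>, at \<open>v\<close> and on \<open>Z\<close>.
\<close>

definition forces :: "'a \<Rightarrow> 'a \<Rightarrow> 'a set \<Rightarrow> real option \<Rightarrow> bool" where
  "forces p v Z r \<longleftrightarrow> (\<forall>f. (\<forall>x\<in>branch p v. eig f x) \<longrightarrow> (\<forall>z\<in>Z. f z = 0) \<longrightarrow>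
     (case r of Some e \<Rightarrow> f v = e * f p | None \<Rightarrow> f p = 0) \<and>
     (f p = 0 \<longrightarrow> f v = 0 \<longrightarrow> (\<forall>x\<in>branch p v. f x = 0)))"

lemma forcesD:
  assumes "forces p v Z r" "\<And>x. x \<in> branch p v \<Longrightarrow> eig f x" "\<And>z. z \<in> Z \<Longrightarrow> f z = 0"
  shows "r = Some e \<Longrightarrow> f v = e * f p" "r = None \<Longrightarrow> f p = 0"
    "f p = 0 \<Longrightarrow> f v = 0 \<Longrightarrow> x \<in> branch p v \<Longrightarrow> f x = 0"
  using assms unfolding forces_def by (auto split: option.splits)

text \<open>
  The last conjunct singles out the only branch that attains \<open>6 * card Z + 5\<close>; the case of equality in
  the final bound rests on it.
\<close>

definition certifies :: "'a \<Rightarrow> 'a \<Rightarrow> 'a set \<Rightarrow> real option \<Rightarrow> bool" where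
  "certifies p v Z r \<longleftrightarrow> Z \<subseteq> branch p v \<and> forces p v Z r \<and> 
     6 * card Z + excess r \<le> card (branch p v) \<and>
     (card (branch p v) = 6 * card Z + 5 \<longrightarrow> core v = {p} \<and> card (arms v) = 2)"

lemma branch_size:
  assumes v: "v \<in> R" and C: "C \<subseteq> core v"
  shows "card (insert v (\<Union>c\<in>arms v \<union> C. branch v c)) = 1 + 2 * card (arms v) + (\<Sum>c\<in>C. card (branch v c))"
proof -
  have "arms v \<union> C \<subseteq> nbrs v" using C nbrs_R[OF v] by auto
  then have "card (insert v (\<Union>c\<in>arms v \<union> C. branch v c)) = 1 + (\<Sum>c\<in>arms v \<union> C. card (branch v c))"
    by (rule card_insert_branches)
  also have "(\<Sum>c\<in>arms v \<union> C. card (branch v c)) = (\<Sum>c\<in>arms v. card (branch v c)) + (\<Sum>c\<in>C. card (branch v c))"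
    using C nbrs_R[OF v] finite_subset[OF C finite_core] by (intro sum.union_disjoint) auto
  also have "(\<Sum>c\<in>arms v. card (branch v c)) = 2 * card (arms v)"
    using card_arm[OF v] by simp
  finally show ?thesis by simp
qed

lemma branch_R:
  assumes "v \<in> R" "p \<in> core v"
  shows "branch p v = insert v (\<Union>c\<in>arms v \<union> (core v - {p}). branch v c)"
proof -
  have "nbrs v - {p} = arms v \<union> (core v - {p})" using assms nbrs_R[OF assms(1)] by auto
  then show ?thesis using branch_decomp[of p v] core_edge[OF assms(2)] edge_sym by auto
qed

lemma V_R: "r \<in> R \<Longrightarrow> V = insert r (\<Union>c\<in>arms r \<union> core r. branch r c)"
  using V_decomp[OF R_in_V] nbrs_R(1) by metis

text \<open>
  The step from the children \<open>C\<close> of \<open>v\<close> to \<open>v\<close> is the same inside a branch and at the root.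
\<close>

context
  fixes v C Z r
  assumes v: "v \<in> R" and C: "C \<subseteq> core v" and cert: "\<And>c. c \<in> C \<Longrightarrow> certifies v c (Z c) (r c)"
begin

lemma finC: "finite C" using C finite_core finite_subset by blast

lemma UN_Z_sub: "(\<Union>c\<in>C. Z c) \<subseteq> (\<Union>c\<in>C. branch v c)"
  using cert unfolding certifies_def by blast

lemma card_UN_Z: "card (\<Union>c\<in>C. Z c) \<le> (\<Sum>c\<in>C. card (Z c))"
  by (rule card_UN_le[OF finC])

lemma certificate_sizes: "6 * (\<Sum>c\<in>C. card (Z c)) + (\<Sum>c\<in>C. excess (r c)) \<le> (\<Sum>c\<in>C. card (branch v c))"
  using cert unfolding certifies_def sum_distrib_left sum.distrib[symmetric] by (intro sum_mono) blast

lemma tight_children: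
  assumes "\<not> (\<Sum>c\<in>C. card (branch v c)) > 6 * (\<Sum>c\<in>C. card (Z c)) + 5 * card C" "c \<in> C"
  shows "core c = {v} \<and> card (arms c) = 2"
proof -
  have le: "6 * card (Z c) + 5 \<le> card (branch v c)" if "c \<in> C" for c
    using cert[OF that] excess_bounds(1)[of "r c"] unfolding certifies_def by linarith
  have "card (branch v c) = 6 * card (Z c) + 5"
  proof (rule ccontr)
    assume "\<not> ?thesis"
    then have "6 * card (Z c) + 5 < card (branch v c)" using le[OF assms(2)] by simp
    then have "(\<Sum>c\<in>C. 6 * card (Z c) + 5) < (\<Sum>c\<in>C. card (branch v c))"
      using le assms(2) finC by (intro sum_strict_mono_ex1) auto
    then show False using assms(1) by (simp add: sum.distrib sum_distrib_left)
  qed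
  then show ?thesis using cert[OF assms(2)] unfolding certifies_def by blast
qed

text \<open>
  A child with the relation \<open>None\<close> forces \<open>f v = 0\<close> and leaves its own value free, so one prescribes
  the values at these children, except the one at \<open>c0\<close>, which the row of \<open>v\<close> determines.  A child with relation \<open>None\<close> has excess \<open>9\<close>, more than the \<open>6\<close> vertices needed to pay for
  the prescribed value; the child \<open>c0\<close> contributes its whole excess.
\<close>

lemma some_child_forces_zero:
  assumes "c0 \<in> C" "r c0 = None"
  obtains Y where "Y \<subseteq> (\<Union>c\<in>C. branch v c)"
    "6 * card Y + 9 \<le> (\<Sum>c\<in>C. card (branch v c))"
    "\<forall>f. (\<forall>c\<in>C. \<forall>x\<in>branch v c. eig f x) \<longrightarrow> (\<forall>z\<in>Y. f z = 0) \<longrightarrow>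
      f v = 0 \<and> (\<forall>c\<in>C - {c0}. \<forall>x\<in>branch v c. f x = 0) \<and> (f c0 = 0 \<longrightarrow> (\<forall>x\<in>branch v c0. f x = 0))"
proof -
  define N where "N = {c\<in>C. r c = None}"
  define Y where "Y = (\<Union>c\<in>C. Z c) \<union> (N - {c0})"
  have finN: "finite N" and c0N: "c0 \<in> N" using finC assms by (auto simp: N_def)
  have "Y \<subseteq> (\<Union>c\<in>C. branch v c)" using UN_Z_sub by (auto simp: Y_def N_def)
  moreover have "6 * card Y + 9 \<le> (\<Sum>c\<in>C. card (branch v c))"
  proof -
    have "card Y \<le> (\<Sum>c\<in>C. card (Z c)) + (card N - 1)"
      unfolding Y_def using card_Un_le[of "\<Union>c\<in>C. Z c" "N - {c0}"] card_UN_Z c0N by simp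
    moreover have "card N \<ge> 1" using finN c0N by (metis One_nat_def Suc_leI card_gt_0_iff empty_iff)
    moreover have "9 * card N \<le> (\<Sum>c\<in>C. excess (r c))"
    proof -
      have "9 * card N = (\<Sum>c\<in>N. excess (r c))" by (simp add: N_def excess_def)
      also have "\<dots> \<le> (\<Sum>c\<in>C. excess (r c))" using finC by (intro sum_mono2) (auto simp: N_def)
      finally show ?thesis .
    qed
    ultimately show ?thesis using certificate_sizes by linarith
  qed
  moreover have "f v = 0 \<and> (\<forall>c\<in>C - {c0}. \<forall>x\<in>branch v c. f x = 0) \<and> (f c0 = 0 \<longrightarrow> (\<forall>x\<in>branch v c0. f x = 0))"
    if eig: "\<And>c x. c \<in> C \<Longrightarrow> x \<in> branch v c \<Longrightarrow> eig f x" and zero: "\<And>z. z \<in> Y \<Longrightarrow> f z = 0" for f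
  proof -
    have fo: "forces v c (Z c) (r c)" if "c \<in> C" for c using cert[OF that] unfolding certifies_def by blast
    have z: "f x = 0" if "c \<in> C" "x \<in> Z c" for c x using zero that by (auto simp: Y_def)
    have v0: "f v = 0"
      by (rule forcesD(2)[OF fo[OF assms(1)] eig[OF assms(1)] z[OF assms(1)] assms(2)])
    have "f c = 0" if "c \<in> C" "c \<noteq> c0" for c
    proof (cases "r c")
      case None
      then show ?thesis using zero that by (auto simp: Y_def N_def)
    next
      case (Some e)
      then show ?thesis
        using forcesD(1)[OF fo[OF that(1)] eig[OF that(1)] z[OF that(1)] Some] v0 by simp
    qed
    moreover have "f x = 0" if "c \<in> C" "f c = 0" "x \<in> branch v c" for c x
      by (rule forcesD(3)[OF fo[OF that(1)] eig[OF that(1)] z[OF that(1)] v0 that(2,3)])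
    ultimately show ?thesis using v0 assms(1) by blast
  qed
  ultimately show ?thesis by (intro that) blast+
qed

lemma all_children_proportional:
  assumes "\<And>c. c \<in> C \<Longrightarrow> r c = Some (e c)"
    and eig: "\<And>c x. c \<in> C \<Longrightarrow> x \<in> branch v c \<Longrightarrow> eig f x" 
    and zero: "\<And>z. z \<in> (\<Union>c\<in>C. Z c) \<Longrightarrow> f z = 0"
  shows "(\<Sum>c\<in>C. f c) = (\<Sum>c\<in>C. e c) * f v" "f v = 0 \<Longrightarrow> c \<in> C \<Longrightarrow> x \<in> branch v c \<Longrightarrow> f x = 0"
proof -
  have fo: "forces v c (Z c) (r c)" if "c \<in> C" for c using cert[OF that] unfolding certifies_def by blast
  have fc: "f c = e c * f v" if "c \<in> C" for c
    by (rule forcesD(1)[OF fo[OF that] _ _ assms(1)[OF that]]) (use eig zero that in auto)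
  then show "(\<Sum>c\<in>C. f c) = (\<Sum>c\<in>C. e c) * f v" by (simp add: sum_distrib_right)
  show "f x = 0" if "f v = 0" "c \<in> C" "x \<in> branch v c"
    by (rule forcesD(3)[OF fo[OF that(2)] eig[OF that(2)] zero that(1) _ that(3)]) (use that fc in auto)
qed

end

text \<open>
  Induction from the ends of the tree induced on \<open>R\<close> towards the root.  The row of \<open>v\<close> reads
  \<open>f p = a * f v + (\<Sum>c. f v - f c)\<close>, which for proportional children is \<open>f p = D * f v\<close> with
  \<open>D = a + (\<Sum>c. 1 - e c)\<close>; if some child forces \<open>f v = 0\<close>, the ratio at \<open>v\<close> is \<open>0\<close>.
\<close>

lemma branch_certificate:
  assumes "v \<in> R" "p \<in> core v"
  shows "\<exists>Z r. certifies p v Z r"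
  using assms
proof (induction "card (branch p v)" arbitrary: p v rule: less_induct)
  case less
  note v = less.prems(1) and p = less.prems(2)
  define C where "C = core v - {p}"
  have finC: "finite C" and CC: "C \<subseteq> core v" by (auto simp: C_def)
  have pv: "(p, v) \<in> E" using core_edge(1)[OF p] by (rule edge_sym)
  have "\<exists>Z r. certifies v c Z r" if "c \<in> C" for c
  proof (rule less.hyps)
    have c: "c \<in> core v" "c \<noteq> p" using that by (auto simp: C_def)
    show "card (branch v c) < card (branch p v)"
      using child_branch_psubset[OF pv core_edge(1)[OF c(1)] c(2)] finite_branch[OF R_in_V[OF v]]
      by (rule psubset_card_mono[rotated])
    show "c \<in> R" using core_edge(2)[OF c(1)] .
    show "v \<in> core c" using core_sym[OF v c(1)] .
  qed
  then obtain Z r where cert: "\<And>c. c \<in> C \<Longrightarrow> certifies v c (Z c) (r c)" by metis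
  note loc = v CC cert
  define a where "a = card (arms v)"
  have br: "branch p v = insert v (\<Union>c\<in>arms v \<union> C. branch v c)"
    unfolding C_def by (rule branch_R[OF v p])
  have size: "card (branch p v) = 1 + 2 * a + (\<Sum>c\<in>C. card (branch v c))"
    unfolding br a_def by (rule branch_size[OF v CC])
  have core: "core v = insert p C" "p \<notin> C" using p by (auto simp: C_def)
  have cardcore: "card (core v) = card C + 1" using core finC by simp
  have in_br: "c \<in> arms v \<union> C \<Longrightarrow> x \<in> branch v c \<Longrightarrow> x \<in> branch p v" for c x unfolding br by blast
  have eq: "f p + (\<Sum>c\<in>C. f c) = (real a + real (card C)) * f v"
    if "\<And>x. x \<in> branch p v \<Longrightarrow> eig f x" for f
  proof -
    have "(\<Sum>u\<in>core v. f u) = (real (card (arms v)) + real (card (core v)) - 1) * f v"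
      by (rule eig_core[OF v]) (use that in_br in auto)
    then show ?thesis using core finC cardcore by (simp add: a_def)
  qed
  have arm0: "f x = 0" if "\<And>x. x \<in> branch p v \<Longrightarrow> eig f x" "f v = 0" "q \<in> arms v" "x \<in> branch v q" for f q x
    by (rule arm_eig(2)[of v q f x, OF v that(3) _ that(2,4)]) (use that in_br in auto)
  have vanish: "f x = 0" if eigf: "\<And>x. x \<in> branch p v \<Longrightarrow> eig f x" and v0: "f v = 0" and
      z: "\<And>c y. c \<in> C \<Longrightarrow> y \<in> branch v c \<Longrightarrow> f y = 0" and xb: "x \<in> branch p v" for f x
  proof -
    consider "x = v" | q where "q \<in> arms v" "x \<in> branch v q" | c where "c \<in> C" "x \<in> branch v c"
      using xb br by blast
    then show ?thesis
      by cases (use eigf v0 z arm0[OF eigf v0] in blast)+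
  qed
  show ?case
  proof (cases "\<exists>c0\<in>C. r c0 = None")
    case True
    then obtain c0 where c0: "c0 \<in> C" "r c0 = None" by blast
    obtain Y where Y: "Y \<subseteq> (\<Union>c\<in>C. branch v c)"
    "6 * card Y + 9 \<le> (\<Sum>c\<in>C. card (branch v c))"
    "\<forall>f. (\<forall>c\<in>C. \<forall>x\<in>branch v c. eig f x) \<longrightarrow> (\<forall>z\<in>Y. f z = 0) \<longrightarrow>
      f v = 0 \<and> (\<forall>c\<in>C - {c0}. \<forall>x\<in>branch v c. f x = 0) \<and> (f c0 = 0 \<longrightarrow> (\<forall>x\<in>branch v c0. f x = 0))"
      by (rule some_child_forces_zero[OF loc c0])
    have "forces p v Y (Some 0)"
      unfolding forces_def
    proof (intro allI impI)
      fix f assume eig: "\<forall>x\<in>branch p v. eig f x" and zero: "\<forall>z\<in>Y. f z = 0"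
      have *: "f v = 0 \<and> (\<forall>c\<in>C - {c0}. \<forall>x\<in>branch v c. f x = 0) \<and> (f c0 = 0 \<longrightarrow> (\<forall>x\<in>branch v c0. f x = 0))"
        by (rule Y(3)[rule_format]) (use eig zero in_br in auto)
      have "f p + (\<Sum>c\<in>C. f c) = 0" using eq[of f] eig * by simp
      moreover have "(\<Sum>c\<in>C. f c) = f c0"
        unfolding sum.remove[OF finC c0(1)] using * by (simp add: sum.neutral)
      ultimately have "f y = 0" if "f p = 0" "c \<in> C" "y \<in> branch v c" for c y
        using * that by (cases "c = c0") auto
      then have "\<forall>x\<in>branch p v. f x = 0" if "f p = 0"
        using vanish[of f] eig * that by blast
      moreover have "f v = 0" using * by blast
      ultimately show "(case Some 0 of Some e \<Rightarrow> f v = e * f p | None \<Rightarrow> f p = 0) \<and>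
         (f p = 0 \<longrightarrow> f v = 0 \<longrightarrow> (\<forall>x\<in>branch p v. f x = 0))"
        by simp
    qed
    moreover have "Y \<subseteq> branch p v" using Y(1) br by blast
    ultimately have "certifies p v Y (Some 0)"
      using Y(2) size by (auto simp: certifies_def excess_def)
    then show ?thesis by blast
  next
    case False
    define e where "e c = the (r c)" for c
    have e: "r c = Some (e c)" if "c \<in> C" for c
      using False that by (auto simp: e_def)
    define D where "D = real a + (\<Sum>c\<in>C. 1 - e c)"
    define r' where "r' = (if D = 0 then None else Some (1 / D))"
    define Y where "Y = (\<Union>c\<in>C. Z c)"
    have "forces p v Y r'"
      unfolding forces_def
    proof (intro allI impI)
      fix f assume eig: "\<forall>x\<in>branch p v. eig f x" and zero: "\<forall>z\<in>Y. f z = 0"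
      have s: "(\<Sum>c\<in>C. f c) = (\<Sum>c\<in>C. e c) * f v" 
        by (rule all_children_proportional(1)[OF loc e]) (use eig in_br zero in \<open>unfold Y_def, blast+\<close>)
      have z: "f x = 0" if "f v = 0" "c \<in> C" "x \<in> branch v c" for x c
        by (rule all_children_proportional(2)[where f = f, OF loc e _ _ that]) (use eig in_br zero in \<open>unfold Y_def, blast+\<close>)
      have "f p = D * f v"
        using eq[of f] eig s by (simp add: D_def sum_subtractf algebra_simps)
      moreover have "\<forall>x\<in>branch p v. f x = 0" if "f v = 0"
        using vanish[of f] eig z that by blast
      ultimately show "(case r' of Some e \<Rightarrow> f v = e * f p | None \<Rightarrow> f p = 0) \<and>
         (f p = 0 \<longrightarrow> f v = 0 \<longrightarrow> (\<forall>x\<in>branch p v. f x = 0))"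
        by (simp add: r'_def)
    qed
    moreover have "Y \<subseteq> branch p v" using UN_Z_sub[OF loc] unfolding Y_def br by blast
    moreover have "6 * card Y + excess r' \<le> card (branch p v) \<and>
      (card (branch p v) = 6 * card Y + 5 \<longrightarrow> core v = {p} \<and> card (arms v) = 2)"
    proof (cases "C = {}")
      case True
      have a2: "2 \<le> a" unfolding a_def by (rule arms_ge_2[OF v]) (use core True in simp)
      have D: "D = real a" by (simp add: D_def True)
      have "excess r' \<le> 1 + 2 * a" 
        using a2 by (cases "a = 2") (auto simp: r'_def D excess_def)
      then show ?thesis using size core True by (auto simp: Y_def a_def)
    next
      case False
      have "max 6 (excess r') \<le> 1 + 2 * a + (\<Sum>c\<in>C. excess (Some (e c)))"
        unfolding r'_def D_def by (rule excess_step[OF finC False])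
      also have "(\<Sum>c\<in>C. excess (Some (e c))) = (\<Sum>c\<in>C. excess (r c))" using e by simp
      finally have "max 6 (excess r') \<le> 1 + 2 * a + (\<Sum>c\<in>C. excess (r c))" .
      then show ?thesis
        using certificate_sizes[OF loc] card_UN_Z[OF loc] size unfolding Y_def by linarith
    qed
    ultimately have "certifies p v Y r'" by (simp add: certifies_def)
    then show ?thesis by blast
  qed
qed

text \<open>
  The tree induced on \<open>R\<close> is a path with three vertices, the ends of which carry two arms each.
\<close>

definition extremal :: "'a \<Rightarrow> 'a \<Rightarrow> 'a \<Rightarrow> bool" where
  "extremal r c c' \<longleftrightarrow> c \<noteq> c' \<and> r \<in> R \<and> arms r = {} \<and> core r = {c, c'} \<and> core c = {r} \<and> core c' = {r} \<and>
     card (arms c) = 2 \<and> card (arms c') = 2"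

text \<open>
  At a root \<open>v\<close> there is no parent, so for proportional children the row of \<open>v\<close> becomes
  \<open>(D - 1) * f v = 0\<close>, and \<open>f v\<close> has to be
  prescribed exactly if \<open>D = 1\<close>.  With \<open>k \<ge> 2\<close> children and \<open>a\<close> arms the tree has at least
  \<open>6 * z + 5 * k + 1 + 2 * a \<ge> 6 * (z + 1) + 5\<close> vertices if \<open>z\<close> values are prescribed below the root.  Equality
  needs \<open>k = 2\<close>, \<open>a = 0\<close> and two branches of the smallest kind.  If a child forces \<open>f v = 0\<close>, the excess
  \<open>9\<close> of that child makes the inequality strict.
\<close>

lemma determining_set_core_ge_2:
  assumes v: "v \<in> R" and c2: "2 \<le> card (core v)"
  obtains Y where "Y \<subseteq> V" "6 * card Y + 5 \<le> card V" 
    "card V = 6 * card Y + 5 \<Longrightarrow> \<exists>c c'. extremal v c c'"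
    "\<And>f x. (\<And>y. y \<in> V \<Longrightarrow> eig f y) \<Longrightarrow> (\<And>z. z \<in> Y \<Longrightarrow> f z = 0) \<Longrightarrow> x \<in> V \<Longrightarrow> f x = 0"
proof -
  have "\<exists>Z r. certifies v c Z r" if "c \<in> core v" for c
    using branch_certificate[OF core_edge(2)[OF that] core_sym[OF v that]] .
  then obtain Z r where cert: "\<And>c. c \<in> core v \<Longrightarrow> certifies v c (Z c) (r c)" by metis
  note loc = v order_refl cert
  define a where "a = card (arms v)"
  have V: "V = insert v (\<Union>c\<in>arms v \<union> core v. branch v c)" by (rule V_R[OF v])
  have size: "card V = 1 + 2 * a + (\<Sum>c\<in>core v. card (branch v c))"
    unfolding V[THEN arg_cong[of _ _ card]] a_def by (rule branch_size[OF v order_refl])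
  have in_V: "c \<in> arms v \<union> core v \<Longrightarrow> x \<in> branch v c \<Longrightarrow> x \<in> V" for c x using V by blast
  have vV: "v \<in> V" by (rule R_in_V[OF v])
  have eq: "(\<Sum>c\<in>core v. f c) = (real a + real (card (core v)) - 1) * f v"
    if "\<And>x. x \<in> V \<Longrightarrow> eig f x" for f
    unfolding a_def by (rule eig_core[OF v that[OF vV] that[OF in_V]]) auto
  have all0: "f x = 0" if "\<And>x. x \<in> V \<Longrightarrow> eig f x" "f v = 0" 
      "\<And>c y. c \<in> core v \<Longrightarrow> y \<in> branch v c \<Longrightarrow> f y = 0" "x \<in> V" for f x
  proof -
    consider "x = v" | q where "q \<in> arms v" "x \<in> branch v q" | c where "c \<in> core v" "x \<in> branch v c"
      using \<open>x \<in> V\<close> V by blast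
    then show ?thesis
    proof cases
      case 2
      show ?thesis by (rule arm_eig(2)[of v q f x, OF v 2(1) _ that(2) 2(2)]) (use that(1) in_V 2 in auto)
    qed (use that in auto)
  qed
  have excess5: "5 * card (core v) \<le> (\<Sum>c\<in>core v. excess (r c))"
    using sum_mono[of "core v" "\<lambda>_. 5" "\<lambda>c. excess (r c)"] excess_bounds by simp
  have fin: "finite (core v)" by simp
  show ?thesis
  proof (cases "\<exists>c0\<in>core v. r c0 = None")
    case True
    then obtain c0 where c0: "c0 \<in> core v" "r c0 = None" by blast
    obtain Y where Y: "Y \<subseteq> (\<Union>c\<in>core v. branch v c)"
    "6 * card Y + 9 \<le> (\<Sum>c\<in>core v. card (branch v c))"
    "\<forall>f. (\<forall>c\<in>core v. \<forall>x\<in>branch v c. eig f x) \<longrightarrow> (\<forall>z\<in>Y. f z = 0) \<longrightarrow>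
      f v = 0 \<and> (\<forall>c\<in>core v - {c0}. \<forall>x\<in>branch v c. f x = 0) \<and> (f c0 = 0 \<longrightarrow> (\<forall>x\<in>branch v c0. f x = 0))"
      by (rule some_child_forces_zero[OF loc c0])
    show ?thesis
    proof (rule that)
      show "Y \<subseteq> V" using Y(1) V by blast
      show "6 * card Y + 5 \<le> card V" using Y(2) size by linarith
      show "\<exists>c c'. extremal v c c'" if "card V = 6 * card Y + 5" using that Y(2) size by linarith
      fix f x assume eig: "\<And>y. y \<in> V \<Longrightarrow> eig f y" and zero: "\<And>z. z \<in> Y \<Longrightarrow> f z = 0" and x: "x \<in> V"
      have *: "f v = 0 \<and> (\<forall>c\<in>core v - {c0}. \<forall>x\<in>branch v c. f x = 0) \<and> (f c0 = 0 \<longrightarrow> (\<forall>x\<in>branch v c0. f x = 0))"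
        by (rule Y(3)[rule_format]) (use eig zero in_V in auto)
      have "(\<Sum>c\<in>core v. f c) = f c0"
        unfolding sum.remove[OF fin c0(1)] using * by (simp add: sum.neutral)
      then have "f c0 = 0" using eq[OF eig] * by simp
      then have "f y = 0" if "c \<in> core v" "y \<in> branch v c" for c y
        using * that by (cases "c = c0") auto
      then show "f x = 0" using all0[OF eig _ _ x] * by blast
    qed
  next
    case False
    define e where "e c = the (r c)" for c
    have e: "r c = Some (e c)" if "c \<in> core v" for c
      using False that by (auto simp: e_def)
    define D where "D = real a + (\<Sum>c\<in>core v. 1 - e c)"
    define Y0 where "Y0 = (\<Union>c\<in>core v. Z c)"
    define Y where "Y = (if D = 1 then insert v Y0 else Y0)"
    have Y0: "card Y0 \<le> (\<Sum>c\<in>core v. card (Z c))" 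
      unfolding Y0_def by (rule card_UN_Z[OF loc])
    have "Y0 \<subseteq> V" using UN_Z_sub[OF loc] V unfolding Y0_def by blast
    then have YV: "Y \<subseteq> V" using vV by (auto simp: Y_def)
    have cY: "card Y \<le> card Y0 + 1"
      by (auto simp: Y_def card_insert_le_m1 intro: card_insert_le_m1)
    show ?thesis
    proof (rule that)
      show "Y \<subseteq> V" by (rule YV)
      show "6 * card Y + 5 \<le> card V"
        using Y0 cY excess5 c2 size certificate_sizes[OF loc] by linarith
      show "\<exists>c c'. extremal v c c'" if eqV: "card V = 6 * card Y + 5"
      proof -
        have "card (core v) = 2" "a = 0" 
          and sm: "\<not> (\<Sum>c\<in>core v. card (branch v c)) > 6 * (\<Sum>c\<in>core v. card (Z c)) + 5 * card (core v)"
          using eqV Y0 cY excess5 c2 size certificate_sizes[OF loc] by linarith+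
        then obtain c c' where cc: "core v = {c, c'}" "c \<noteq> c'" by (auto simp: card_2_iff)
        have "arms v = {}" using \<open>a = 0\<close> by (simp add: a_def)
        then have "extremal v c c'"
          using cc v tight_children[OF loc sm, of c] tight_children[OF loc sm, of c'] by (auto simp: extremal_def)
        then show ?thesis by blast
      qed
      fix f x assume eig: "\<And>y. y \<in> V \<Longrightarrow> eig f y" and zero: "\<And>z. z \<in> Y \<Longrightarrow> f z = 0" and x: "x \<in> V"
      have zero0: "\<And>z. z \<in> Y0 \<Longrightarrow> f z = 0" using zero by (auto simp: Y_def split: if_splits)
      have "(\<Sum>c\<in>core v. f c) = (\<Sum>c\<in>core v. e c) * f v"
        by (rule all_children_proportional(1)[OF loc e]) (use eig in_V zero0 in \<open>unfold Y0_def, blast+\<close>)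
      then have "(D - 1) * f v = 0"
        using eq[OF eig] by (simp add: D_def sum_subtractf algebra_simps)
      then have v0: "f v = 0" using zero by (cases "D = 1") (auto simp: Y_def)
      have "f y = 0" if "c \<in> core v" "y \<in> branch v c" for c y
        by (rule all_children_proportional(2)[where f = f, OF loc e _ _ v0 that]) (use eig in_V zero0 in \<open>unfold Y0_def, blast+\<close>)
      then show "f x = 0" using all0[OF eig v0 _ x] by blast
    qed
  qed
qed

text \<open>
  Here \<open>R\<close> has at most two vertices.  A single vertex has \<open>a \<ge> 3\<close> arms, because of the size of the tree,
  and its row is \<open>(a - 1) * f v = 0\<close>.  Two vertices with \<open>a\<close> and \<open>a'\<close> arms satisfy \<open>f v = a * a' * f v\<close>, where
  \<open>a\<close> and \<open>a'\<close> are at least \<open>2\<close>.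
\<close>

lemma eig_small_core:
  assumes "v \<in> R" and small: "\<And>u. u \<in> R \<Longrightarrow> card (core u) \<le> 1" and V7: "7 \<le> card V"
    and eig: "\<And>y. y \<in> V \<Longrightarrow> eig f y" and x: "x \<in> V"
  shows "f x = 0"
proof -
  have V: "V = insert v (\<Union>c\<in>arms v \<union> core v. branch v c)" if "v \<in> R" for v by (rule V_R[OF that])
  have eqs: "(\<Sum>c\<in>core v. f c) = (real (card (arms v)) + real (card (core v)) - 1) * f v" if "v \<in> R" for v
    by (rule eig_core[OF that eig[OF R_in_V[OF that]] eig]) (use V[OF that] in blast)
  have all_arms: "f x = 0" if "v \<in> R" "f v = 0" "q \<in> arms v" "x \<in> branch v q" for v q x
    by (rule arm_eig(2)[of v q f x, OF that(1,3) eig that(2,4)]) (use V[OF that(1)] that in blast)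
  note v = \<open>v \<in> R\<close>
  consider "core v = {}" | c where "core v = {c}"
    using small[OF v] by (metis card_0_eq card_1_singletonE finite_core le_SucE le_zero_eq One_nat_def)
  then show ?thesis
  proof cases
    case 1
    have "card V = 1 + 2 * card (arms v)"
      using branch_size[OF v, of "{}"] 1 V[OF v] by simp
    then have "3 \<le> card (arms v)" using V7 by linarith
    then have "f v = 0" using eqs[OF v] 1 by auto
    then show ?thesis using x V[OF v] 1 all_arms[OF v] by auto
  next
    case 2
    then have c: "c \<in> R" "(v, c) \<in> E" "v \<in> core c" 
      using core_edge[of c v] core_sym[OF v, of c] by auto
    have cc: "core c = {v}"
      using card_seteq[of "core c" "{v}"] card_seteq[OF finite_core, of "{v}" c] small[OF c(1)] c(3) by simp
    have ge: "2 \<le> card (arms v)" "2 \<le> card (arms c)"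
      using arms_ge_2[OF v 2] arms_ge_2[OF c(1) cc] by auto
    have "f c = real (card (arms v)) * f v" "f v = real (card (arms c)) * f c"
      using eqs[OF v] eqs[OF c(1)] 2 cc by auto
    then have "(1 - real (card (arms c) * card (arms v))) * f v = 0"
      by (simp only: of_nat_mult left_diff_distrib mult.assoc)
    moreover have "card (arms c) * card (arms v) \<noteq> 1" using ge by auto
    ultimately have v0: "f v = 0" by (metis mult_eq_0_iff of_nat_eq_1_iff right_minus_eq)
    then have c0: "f c = 0" using \<open>f c = _\<close> by simp
    have "branch v c = insert c (\<Union>q\<in>arms c. branch c q)"
      using branch_R[OF c(1,3)] cc by simp
    then show ?thesis using x V[OF v] 2 all_arms[OF v v0] all_arms[OF c(1) c0] v0 c0 by auto
  qed
qed

lemma determining_set: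
  assumes "R \<noteq> {}" "7 \<le> card V"
  obtains Y where "Y \<subseteq> V" "6 * card Y + 5 \<le> card V" 
    "card V = 6 * card Y + 5 \<Longrightarrow> \<exists>v c c'. extremal v c c'"
    "\<And>f x. (\<And>y. y \<in> V \<Longrightarrow> eig f y) \<Longrightarrow> (\<And>z. z \<in> Y \<Longrightarrow> f z = 0) \<Longrightarrow> x \<in> V \<Longrightarrow> f x = 0"
proof (cases "\<exists>v\<in>R. 2 \<le> card (core v)")
  case True
  then obtain v where v: "v \<in> R" "2 \<le> card (core v)" by blast
  show ?thesis by (rule determining_set_core_ge_2[OF v]) (use that in blast)
next
  case False
  then have small: "\<And>v. v \<in> R \<Longrightarrow> card (core v) \<le> 1" by fastforce
  obtain v where v: "v \<in> R" using assms(1) by blast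
  show ?thesis
    using eig_small_core[OF v small assms(2)] assms(2) by (intro that[of "{}"]) auto
qed

lemma extremal_layout:
  assumes "extremal v c c'"
  obtains q1 l1 q2 l2 q3 l3 q4 l4 where
    "V = {c, v, c', q1, l1, q2, l2, q3, l3, q4, l4}"
    "distinct [c, v, c', q1, l1, q2, l2, q3, l3, q4, l4]"
    "nbrs c = {v, q1, q2}" "nbrs v = {c, c'}" "nbrs c' = {v, q3, q4}"
    "nbrs q1 = {c, l1}" "nbrs l1 = {q1}" "nbrs q2 = {c, l2}" "nbrs l2 = {q2}"
    "nbrs q3 = {c', l3}" "nbrs l3 = {q3}" "nbrs q4 = {c', l4}" "nbrs l4 = {q4}"
proof -
  have v: "v \<in> R" and cc: "c \<noteq> c'" "core v = {c, c'}" "arms v = {}" 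
    and end1: "core c = {v}" "card (arms c) = 2" and end2: "core c' = {v}" "card (arms c') = 2"
    using assms by (auto simp: extremal_def)
  have half: "\<exists>q l q' l'. nbrs u = {v, q, q'} \<and> nbrs q = {u, l} \<and> nbrs l = {q} \<and> 
      nbrs q' = {u, l'} \<and> nbrs l' = {q'} \<and> branch v u = {u, q, l, q', l'} \<and> card (branch v u) = 5"
    if u: "u \<in> core v" "core u = {v}" "card (arms u) = 2" for u
  proof -
    have uR: "u \<in> R" using core_edge(2)[OF u(1)] .
    obtain q q' where q: "arms u = {q, q'}" using u(3) by (auto simp: card_2_iff)
    obtain l where l: "nbrs q = {u, l}" "nbrs l = {q}" "branch u q = {q, l}"
      using arm_leaf[OF uR, of q] q by (metis insertI1)
    obtain l' where l': "nbrs q' = {u, l'}" "nbrs l' = {q'}" "branch u q' = {q', l'}"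
      using arm_leaf[OF uR, of q'] q by (metis insertI1 insertI2)
    have "v \<in> core u" using u(2) by simp
    then have br: "branch v u = insert u (\<Union>c\<in>arms u \<union> {}. branch u c)"
      using branch_R[OF uR] u(2) by simp
    have "card (branch v u) = 5" unfolding br branch_size[OF uR empty_subsetI] u(3) by simp
    moreover have "branch v u = {u, q, l, q', l'}" using br q l l' by auto
    moreover have "nbrs u = {v, q, q'}" using nbrs_R(1)[OF uR] u(2) q by auto
    ultimately show ?thesis using l l' by blast
  qed
  obtain q1 l1 q2 l2 where 1: "nbrs c = {v, q1, q2}" "nbrs q1 = {c, l1}" "nbrs l1 = {q1}" 
      "nbrs q2 = {c, l2}" "nbrs l2 = {q2}" "branch v c = {c, q1, l1, q2, l2}" "card (branch v c) = 5"
    using half[OF _ end1] cc(2) by blast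
  obtain q3 l3 q4 l4 where 2: "nbrs c' = {v, q3, q4}" "nbrs q3 = {c', l3}" "nbrs l3 = {q3}" 
      "nbrs q4 = {c', l4}" "nbrs l4 = {q4}" "branch v c' = {c', q3, l3, q4, l4}" "card (branch v c') = 5"
    using half[OF _ end2] cc(2) by blast
  have "nbrs v = {c, c'}" using nbrs_R(1)[OF v] cc by simp
  moreover have V: "V = insert v (\<Union>u\<in>arms v \<union> core v. branch v u)" by (rule V_R[OF v])
  then have V11: "V = {c, v, c', q1, l1, q2, l2, q3, l3, q4, l4}" using 1(6) 2(6) cc by auto
  moreover have "distinct [c, v, c', q1, l1, q2, l2, q3, l3, q4, l4]"
  proof (rule card_distinct)
    have "card V = 11"
      using branch_size[OF v order_refl] V cc 1(7) 2(7) by simp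
    then show "card (set [c, v, c', q1, l1, q2, l2, q3, l3, q4, l4]) = length [c, v, c', q1, l1, q2, l2, q3, l3, q4, l4]"
      using V11 by (simp only: list.set list.size)
  qed
  ultimately show ?thesis using that 1 2 by blast
qed

end

section \<open>Trees as pair graphs\<close>

lemma pair_graph_conn:
  assumes "conn_graph G" "u \<in> pverts G" "v \<in> pverts G"
  shows "(u, v) \<in> (parcs G)\<^sup>*"
proof -
  interpret pair_graph G using assms(1) by (simp add: conn_graph_def)
  have "strongly_connected (with_proj G)"
    using assms(1) sym_arcs by (intro symmetric_connected_imp_strongly_connected) (simp_all add: conn_graph_def)
  then have "u \<rightarrow>\<^sup>*\<^bsub>with_proj G\<^esub> v" using assms by (auto simp: strongly_connected_def)
  then have "(u, v) \<in> (arcs_ends (with_proj G))\<^sup>*" by (rule reachable_rtranclI)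
  then show ?thesis by simp
qed

lemma degree_of_eq_card: "degree_of G v = card (parcs G `` {v})"
proof -
  have "out_arcs (with_proj G) v = Pair v ` (parcs G `` {v})" by (auto simp: out_arcs_def)
  then show ?thesis by (simp add: out_degree_def card_image inj_on_def)
qed

text \<open>
  A path from \<open>c\<close> to \<open>c'\<close> avoiding \<open>v\<close> is shortened to a simple one in the graph without \<open>v\<close> and closed
  through \<open>v\<close>; as \<open>c \<noteq> c'\<close>, the resulting cycle has length at least three.
\<close>

lemma tree_graph_acyclic:
  assumes T: "tree_graph T" and c: "(v, c) \<in> parcs T" "(v, c') \<in> parcs T"
    and path: "(c, c') \<in> {(a, b) \<in> parcs T. a \<noteq> v \<and> b \<noteq> v}\<^sup>*"
  shows "c = c'"
proof (rule ccontr)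
  assume neq: "c \<noteq> c'"
  interpret pair_graph T using T by (simp add: tree_graph_def conn_graph_def)
  have symE: "(a, b) \<in> parcs T \<Longrightarrow> (b, a) \<in> parcs T" for a b
    using sym_arcs by (auto simp: symmetric_def dest: symD)
  have loop: "(a, a) \<notin> parcs T" for a using pair_no_loops[of "(a, a)"] by auto
  let ?A = "{(a, b) \<in> parcs T. a \<noteq> v \<and> b \<noteq> v}"
  define G where "G = \<lparr> pverts = pverts T - {v}, parcs = ?A \<rparr>"
  have G: "pverts G = pverts T - {v}" "parcs G = ?A" by (simp_all add: G_def)
  interpret G: pair_wf_digraph G
    by unfold_locales (auto simp: G dest: in_arcsD1 in_arcsD2)
  have "(c, c') \<in> rtrancl_on (pverts G) (parcs G)"
    using path
  proof (induction rule: rtrancl_induct)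
    case base
    show ?case using c loop in_arcsD2[OF c(1)] by (intro rtrancl_on_refl) (auto simp: G)
  next
    case (step x y)
    then show ?case by (auto simp: G intro!: rtrancl_on_into_rtrancl_on[where b = x] dest: in_arcsD2)
  qed
  then have "c \<rightarrow>\<^sup>*\<^bsub>with_proj G\<^esub> c'" by (simp add: reachable_def)
  then obtain p where p: "G.apath c p c'" using G.reachable_apath by blast
  then have p1: "set p \<subseteq> parcs T" "pcas c p c'" "distinct (pawalk_verts c p)"
    by (auto simp: G.apath_def G.awalk_def G)
  have "v \<notin> set (pawalk_verts c p)"
    using G.awalk_verts_in_verts[of c p v] p by (auto simp: G.apath_def G)
  have verts: "pawalk_verts u (p @ [(c', v)]) = pawalk_verts u p @ [v]" if "pcas u p c'" for u
    using that by (induction p arbitrary: u) auto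
  have cas: "pcas u (p @ [(c', v)]) v" if "pcas u p c'" for u
    using that by (induction p arbitrary: u) auto
  define w where "w = (v, c) # p @ [(c', v)]"
  have "awalk v w v"
    unfolding awalk_def w_def using c p1 symE in_arcsD1[OF c(1)] cas by auto
  moreover have "distinct (tl (pawalk_verts v w))"
    unfolding w_def using verts[OF p1(2)] p1(3) \<open>v \<notin> _\<close> by simp
  ultimately have "cycle w" unfolding cycle_def by (auto simp: w_def)
  moreover have "3 \<le> length w"
    using p1(2) neq unfolding w_def by (cases p) auto
  ultimately show False using T unfolding tree_graph_def by blast
qed

lemma finite_tree_of_tree_graph:
  assumes T: "tree_graph T"
  shows "finite_tree (pverts T) (parcs T)"
proof -
  have cg: "conn_graph T" using T by (simp add: tree_graph_def)
  interpret pair_graph T using T by (simp add: tree_graph_def conn_graph_def)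
  show ?thesis
  proof
    show "finite (pverts T)" by (rule pair_finite_verts)
    show "parcs T \<subseteq> pverts T \<times> pverts T" by (auto dest: in_arcsD1 in_arcsD2)
    show "sym (parcs T)" using sym_arcs by (simp add: symmetric_def)
    show "irrefl (parcs T)" using pair_no_loops by (force simp: irrefl_def)
  qed (use pair_graph_conn[OF cg] tree_graph_acyclic[OF T] in auto)
qed

lemma conn_graphI:
  assumes "finite V" "E \<subseteq> V \<times> V" "sym E" "irrefl E" "V \<noteq> {}" 
    and conn: "\<And>u v. u \<in> V \<Longrightarrow> v \<in> V \<Longrightarrow> (u, v) \<in> E\<^sup>*"
  shows "conn_graph \<lparr> pverts = V, parcs = E \<rparr>"
proof -
  let ?G = "\<lparr> pverts = V, parcs = E \<rparr>"
  have "finite E" using assms(1,2) finite_subset by blast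
  interpret pair_graph ?G
    by unfold_locales (use assms \<open>finite E\<close> in \<open>auto simp: symmetric_def irrefl_def\<close>)
  have "(u, v) \<in> rtrancl_on V (E\<^sup>s)" if "u \<in> V" "v \<in> V" for u v
  proof -
    have "(u, v) \<in> E\<^sup>*" using conn that by blast
    then show ?thesis
    proof (induction rule: rtrancl_induct)
      case (step y z)
      have "(y, z) \<in> E\<^sup>s" using step.hyps(2) by (simp add: symcl_def)
      then show ?case using step assms(2) by (auto intro: rtrancl_on_into_rtrancl_on)
    qed (use that in auto)
  qed
  then show ?thesis using \<open>V \<noteq> {}\<close> pair_graph_axioms by (simp add: conn_graph_def connected_conv)
qed

lemma card_2_other: "card S = 2 \<Longrightarrow> a \<in> S \<Longrightarrow> \<exists>b. S = {a, b} \<and> a \<noteq> b"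
  by (auto simp: card_2_iff)

text \<open>
  The graph left after removing the path \<open>v, q, l\<close> is the branch at \<open>x\<close>, which is connected.
\<close>

lemma (in finite_tree) pendant_P3:
  assumes T: "V = pverts T" "E = parcs T"
    and N: "nbrs v = {q, x}" "nbrs q = {v, l}" "nbrs l = {q}" "q \<noteq> x" "l \<noteq> v" "v \<in> V"
  shows "contains_pendant_path T 3"
proof -
  have vq: "(v, q) \<in> E" and vx: "(v, x) \<in> E" and ql: "(q, l) \<in> E" using N by auto
  have brq: "branch v q = {q, l}"
    using branch_decomp[OF vq] branch_decomp[OF ql] N by (simp add: insert_Diff_if)
  define W where "W = branch v x"
  have V: "V = {v, q, l} \<union> W" using V_decomp[OF N(6)] N(1) brq by (auto simp: W_def)
  have W: "W \<inter> {v, q, l} = {}"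
    using branch_disjoint[OF vx vq] N(4) brq root_notin_branch[OF vx] by (auto simp: W_def)
  have WV: "W \<subseteq> V" using V by blast
  define F where "F = E \<inter> W \<times> W"
  have path: "(x, y) \<in> F\<^sup>*" if "y \<in> W" for y
  proof -
    have "(x, y) \<in> (avoid v)\<^sup>*" using that by (simp add: W_def branch_def)
    then show ?thesis
    proof (induction rule: rtrancl_induct)
      case (step y z)
      have "y \<in> W" "z \<in> W" using step.hyps by (auto simp: W_def branch_def)
      then have "(y, z) \<in> F" using step.hyps by (auto simp: F_def avoid_def)
      then show ?case using step.IH by simp
    qed simp
  qed
  have symF: "sym F" using sym_E by (auto simp: F_def sym_def)
  define H where "H = \<lparr> pverts = W, parcs = F \<rparr>"
  have "conn_graph H"
    unfolding H_def
  proof (rule conn_graphI)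
    show "finite W" using WV finite_V finite_subset by blast
    show "irrefl F" using irrefl_E by (auto simp: F_def irrefl_def)
    show "W \<noteq> {}" unfolding W_def using branch_self[of x v] by blast
    show "(a, b) \<in> F\<^sup>*" if "a \<in> W" "b \<in> W" for a b
      using path[OF that(2)] symD[OF sym_rtrancl[OF symF] path[OF that(1)]] by simp
  qed (auto simp: F_def symF[unfolded F_def])
  moreover have "T = \<lparr> pverts = pverts H \<union> pverts (path_graph [v, q, l]),
      parcs = parcs H \<union> parcs (path_graph [v, q, l]) \<union> {(x, hd [v, q, l]), (hd [v, q, l], x)} \<rparr>"
  proof (rule pair_pre_digraph.equality)
    have "E = F \<union> {(v, q), (q, l), (q, v), (l, q)} \<union> {(x, v), (v, x)}" (is "_ = ?E")
    proof (intro equalityI subrelI)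
      fix a b assume ab: "(a, b) \<in> E"
      then have "(b, a) \<in> E" by (rule edge_sym)
      consider "a \<in> {v, q, l}" | "b \<in> {v, q, l}" | "a \<in> W" "b \<in> W"
        using edge_in_V[OF ab] V by blast
      then show "(a, b) \<in> ?E"
        by cases (use N(1-3) ab \<open>(b, a) \<in> E\<close> in \<open>auto simp: F_def\<close>)
    qed (use vq vx ql edge_sym in \<open>auto simp: F_def\<close>)
    then show "parcs T = parcs \<lparr> pverts = pverts H \<union> pverts (path_graph [v, q, l]),
      parcs = parcs H \<union> parcs (path_graph [v, q, l]) \<union> {(x, hd [v, q, l]), (hd [v, q, l], x)} \<rparr>"
      unfolding T(2) H_def path_graph_def by auto
  qed (use V T(1) in \<open>auto simp: H_def path_graph_def\<close>)
  moreover have "distinct [v, q, l]" using edge_neq[OF vq] edge_neq[OF ql] N(5) by auto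
  moreover have "pverts H \<inter> set [v, q, l] = {}" "x \<in> pverts H" using W by (auto simp: H_def W_def)
  moreover have "length [v, q, l] = 3" "(1::nat) \<le> 3" by simp_all
  ultimately show ?thesis unfolding contains_pendant_path_def by blast
qed

lemma short_arm_tree_of_tree_graph:
  assumes T: "tree_graph T" and noP3: "\<not> contains_pendant_path T 3"
    and Qdeg: "\<forall>v \<in> quasi_pendant_verts T. degree_of T v = 2"
  shows "short_arm_tree (pverts T) (parcs T) (pendant_verts T) (quasi_pendant_verts T)
    (pverts T - pendant_verts T - quasi_pendant_verts T)"
proof -
  interpret finite_tree "pverts T" "parcs T" by (rule finite_tree_of_tree_graph[OF T])
  let ?P = "pendant_verts T" and ?Q = "quasi_pendant_verts T"
  have P: "?P = {v \<in> pverts T. card (nbrs v) = 1}"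
    by (simp add: pendant_verts_def degree_of_eq_card)
  have Q2: "card (nbrs q) = 2" if "q \<in> ?Q" for q using Qdeg that by (simp add: degree_of_eq_card)
  show ?thesis
  proof unfold_locales
    show "?P = {v \<in> pverts T. card (nbrs v) = 1}" by (rule P)
    show "?Q = {v \<in> pverts T. \<exists>u\<in>?P. (v, u) \<in> parcs T}" by (rule quasi_pendant_verts_def)
    show "card (nbrs q) = 2" if "q \<in> ?Q" for q by (rule Q2[OF that])
    show "3 \<le> card (nbrs v)" if v: "v \<in> pverts T - ?P - ?Q" and vq: "(v, q) \<in> parcs T" and q: "q \<in> ?Q" for v q
    proof (rule ccontr)
      assume "\<not> 3 \<le> card (nbrs v)"
      moreover have "card (nbrs v) \<noteq> 0" "card (nbrs v) \<noteq> 1" using vq v by (auto simp: P)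
      ultimately have "card (nbrs v) = 2" by linarith
      then obtain x where x: "nbrs v = {q, x}" "q \<noteq> x" using vq card_2_other[of "nbrs v" q] by auto
      obtain l where l: "l \<in> ?P" "(q, l) \<in> parcs T" using q by (auto simp: quasi_pendant_verts_def)
      have lv: "l \<noteq> v" using l(1) v by auto
      have Nq: "nbrs q = {v, l}" and Nl: "nbrs l = {q}"
        using pendant_path_nbrs[OF vq l(2) lv Q2[OF q]] l(1) by (auto simp: P)
      have "contains_pendant_path T 3"
        by (rule pendant_P3[OF refl refl x(1) Nq Nl x(2) lv]) (use v in auto)
      with noP3 show False ..
    qed
  qed simp
qed

text \<open>
  Without vertices in \<open>R\<close>, the walk from a pendant vertex through its quasi-pendant neighbour ends after
  at most two more vertices.
\<close>

lemma (in short_arm_tree) R_nonempty: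
  assumes "5 \<le> card V"
  shows "R \<noteq> {}"
proof
  assume "R = {}"
  then have all: "v \<in> P \<or> v \<in> Q" if "v \<in> V" for v using that by (auto simp: R_def)
  have "V \<noteq> {}" using assms by auto
  then obtain l where l: "l \<in> P" using all by (fastforce simp: Q_def)
  have pend: "\<exists>q. nbrs l = {q} \<and> q \<in> Q" if l: "l \<in> P" for l
  proof -
    obtain q where q: "nbrs l = {q}" using l by (auto simp: P_def card_1_singleton_iff)
    then have "(l, q) \<in> E" by auto
    then have "q \<in> Q" using l edge_in_V(2) edge_sym unfolding Q_def by blast
    with q show ?thesis by blast
  qed
  obtain q where q: "nbrs l = {q}" "q \<in> Q" using pend[OF l] by blast
  have lq: "(l, q) \<in> E" using q by auto
  have "l \<in> nbrs q" using edge_sym[OF lq] by simp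
  then obtain y where y: "nbrs q = {l, y}" "l \<noteq> y" 
    using card_2_other[of "nbrs q" l] Q_deg[OF q(2)] by auto
  have qy: "(q, y) \<in> E" using y by auto
  have V: "V = {l, q} \<union> branch q y"
    using V_decomp[of l] l branch_decomp[OF lq] q(1) y by (auto simp: P_def insert_Diff_if)
  have "card (branch q y) \<le> 2"
  proof (cases "y \<in> P")
    case True
    then obtain z where "nbrs y = {z}" using pend by blast
    then have "nbrs y = {q}" using edge_sym[OF qy] by auto
    then show ?thesis using branch_decomp[OF qy] by simp
  next
    case False
    then have yQ: "y \<in> Q" using all edge_in_V[OF qy] by blast
    obtain u where u: "u \<in> P" "(y, u) \<in> E" using yQ by (auto simp: Q_def)
    have "u \<noteq> q" using Q_deg[OF q(2)] u(1) by (auto simp: P_def)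
    then have Ny: "nbrs y = {q, u}"
      using card_seteq[of "nbrs y" "{q, u}"] Q_deg[OF yQ] u(2) edge_sym[OF qy] by auto
    obtain z where "nbrs u = {z}" using pend[OF u(1)] by blast
    then have "nbrs u = {y}" using edge_sym[OF u(2)] by auto
    then have "branch y u = {u}" using branch_decomp[OF u(2)] by simp
    then have "branch q y = {y, u}"
      using branch_decomp[OF qy] Ny \<open>u \<noteq> q\<close> by (simp add: insert_Diff_if)
    then show ?thesis by (simp add: card_insert_if)
  qed
  moreover have "card V \<le> card {l, q} + card (branch q y)"
    unfolding V by (rule card_Un_le)
  moreover have "card {l, q} \<le> 2" by (simp add: card_insert_if)
  ultimately show False using assms by linarith
qed

section \<open>The Laplacian matrix\<close>

lemma laplacian_carrier: "laplacian_mat vs G \<in> carrier_mat (length vs) (length vs)"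
  unfolding carrier_mat_def by (simp add: laplacian_mat_def degree_mat_def adjacency_mat_def)

lemma laplacian_mult_vec:
  assumes vs: "distinct vs" "parcs G \<subseteq> set vs \<times> set vs" and i: "i < length vs"
  shows "(laplacian_mat vs G *\<^sub>v vec (length vs) (\<lambda>j. f (vs ! j))) $ i =
    real (card (parcs G `` {vs ! i})) * f (vs ! i) - (\<Sum>u\<in>parcs G `` {vs ! i}. f u)"
proof -
  let ?n = "length vs" and ?N = "parcs G `` {vs ! i}"
  let ?adj = "\<lambda>u. if u \<in> ?N then f u else 0"
  have "(laplacian_mat vs G *\<^sub>v vec ?n (\<lambda>j. f (vs ! j))) $ i =
      (\<Sum>j<?n. laplacian_mat vs G $$ (i, j) * f (vs ! j))"
    using i laplacian_carrier[of vs G] by (auto simp: scalar_prod_def atLeast0LessThan intro!: sum.cong)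
  also have "\<dots> = (\<Sum>j<?n. (if j = i then real (degree_of G (vs ! i)) * f (vs ! i) else 0) - ?adj (vs ! j))"
    using i by (intro sum.cong) (auto simp: laplacian_mat_def degree_mat_def adjacency_mat_def algebra_simps)
  also have "\<dots> = real (card ?N) * f (vs ! i) - (\<Sum>j<?n. ?adj (vs ! j))"
    using i by (simp add: sum_subtractf degree_of_eq_card)
  also have "(\<Sum>j<?n. ?adj (vs ! j)) = (\<Sum>u\<in>set vs. ?adj u)"
    using vs(1) by (intro sum.reindex_bij_betw bij_betw_nth) auto
  also have "\<dots> = (\<Sum>u\<in>set vs \<inter> ?N. f u)" by (simp add: sum.inter_restrict)
  also have "set vs \<inter> ?N = ?N" using vs(2) by blast
  finally show ?thesis .
qed

lemma laplacian_symmetric: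
  assumes "sym (parcs G)"
  shows "(laplacian_mat vs G)\<^sup>T = laplacian_mat vs G"
  using assms by (intro eq_matI) (auto simp: laplacian_mat_def degree_mat_def adjacency_mat_def dest: symD)

lemma laplacian_multiplicity_le:
  assumes vs: "distinct vs" "parcs G \<subseteq> set vs \<times> set vs" and sym: "sym (parcs G)" and Y: "Y \<subseteq> set vs"
    and det: "\<And>f x. (\<And>y. y \<in> set vs \<Longrightarrow>
        real (card (parcs G `` {y})) * f y - (\<Sum>u\<in>parcs G `` {y}. f u) = k * f y) \<Longrightarrow>
      (\<And>y. y \<in> Y \<Longrightarrow> f y = 0) \<Longrightarrow> x \<in> set vs \<Longrightarrow> f x = 0"
  shows "eigenvalue_multiplicity (laplacian_mat vs G) k \<le> card Y"
proof -
  let ?n = "length vs" and ?L = "laplacian_mat vs G"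
  define Z where "Z = {i. i < ?n \<and> vs ! i \<in> Y}"
  have "bij_betw ((!) vs) Z Y"
    unfolding bij_betw_def
  proof
    show "inj_on ((!) vs) Z" using vs(1) by (auto simp: Z_def inj_on_def nth_eq_iff_index_eq)
    show "(!) vs ` Z = Y" using Y by (force simp: Z_def in_set_conv_nth)
  qed
  then have "card Z = card Y" by (rule bij_betw_same_card)
  moreover have "Polynomial.order k (char_poly ?L) \<le> card Z"
  proof (rule order_char_poly_symmetric_le[OF laplacian_carrier laplacian_symmetric[OF sym]])
    show "Z \<subseteq> {..<?n}" by (auto simp: Z_def)
    fix x :: "real vec"
    assume x: "x \<in> carrier_vec ?n" and ev: "?L *\<^sub>v x = k \<cdot>\<^sub>v x" and zero: "\<forall>i\<in>Z. x $ i = 0"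
    define f where "f u = x $ (THE i. i < ?n \<and> vs ! i = u)" for u
    have f: "f (vs ! i) = x $ i" if "i < ?n" for i
    proof -
      have "(THE j. j < ?n \<and> vs ! j = vs ! i) = i"
        using that vs(1) by (intro the_equality) (auto simp: nth_eq_iff_index_eq)
      then show ?thesis by (simp add: f_def)
    qed
    have x_eq: "x = vec ?n (\<lambda>i. f (vs ! i))" using x f by (intro eq_vecI) auto
    have "f u = 0" if "u \<in> set vs" for u
    proof (rule det[OF _ _ that])
      fix y assume "y \<in> set vs"
      then obtain i where i: "i < ?n" "y = vs ! i" by (auto simp: in_set_conv_nth)
      have "(?L *\<^sub>v x) $ i = k * f y" using ev i x f by simp
      then show "real (card (parcs G `` {y})) * f y - (\<Sum>u\<in>parcs G `` {y}. f u) = k * f y"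
        using laplacian_mult_vec[OF vs i(1), of f] i(2) x_eq by simp
    next
      fix y assume "y \<in> Y"
      then obtain i where "i < ?n" "y = vs ! i" using Y by (metis in_set_conv_nth subsetD)
      then show "f y = 0" using zero f \<open>y \<in> Y\<close> by (auto simp: Z_def)
    qed
    then show "x = 0\<^sub>v ?n" using x f by (intro eq_vecI) (auto simp flip: f)
  qed
  ultimately show ?thesis by (simp add: eigenvalue_multiplicity_def)
qed

lemma laplacian_multiplicity_pos:
  assumes vs: "distinct vs" "parcs G \<subseteq> set vs \<times> set vs"
    and ev: "\<And>y. y \<in> set vs \<Longrightarrow>
        real (card (parcs G `` {y})) * f y - (\<Sum>u\<in>parcs G `` {y}. f u) = k * f y"
    and nz: "x \<in> set vs" "f x \<noteq> 0"
  shows "1 \<le> eigenvalue_multiplicity (laplacian_mat vs G) k"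
proof -
  let ?n = "length vs" and ?L = "laplacian_mat vs G"
  let ?x = "vec ?n (\<lambda>i. f (vs ! i))"
  obtain i where i: "i < ?n" "x = vs ! i" using nz(1) by (auto simp: in_set_conv_nth)
  have "?x \<noteq> 0\<^sub>v ?n" using i nz(2) by (metis index_vec index_zero_vec(1))
  moreover have "?L *\<^sub>v ?x = k \<cdot>\<^sub>v ?x"
  proof (rule eq_vecI)
    fix i assume "i < dim_vec (k \<cdot>\<^sub>v ?x)"
    then have i: "i < ?n" by simp
    show "(?L *\<^sub>v ?x) $ i = (k \<cdot>\<^sub>v ?x) $ i"
      using laplacian_mult_vec[OF vs i, of f] ev[of "vs ! i"] i by simp
  qed (use laplacian_carrier[of vs G] in auto)
  ultimately have "eigenvector ?L ?x k"
    using laplacian_carrier[of vs G] by (simp add: eigenvector_def)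
  then have "poly (char_poly ?L) k = 0"
    using eigenvalue_root_char_poly[OF laplacian_carrier] by (auto simp: eigenvalue_def)
  moreover have "char_poly ?L \<noteq> 0" using degree_monic_char_poly[OF laplacian_carrier, of vs G] by auto
  ultimately show ?thesis
    unfolding eigenvalue_multiplicity_def using order_root[of "char_poly ?L" k] by simp
qed

section \<open>The extremal tree\<close>

lemma extremal_tree_simps:
  "pverts extremal_tree = {0..10}"
  "parcs extremal_tree = {(0, 1), (1, 2), (0, 3), (3, 4), (0, 5), (5, 6), (2, 7), (7, 8), (2, 9), (9, 10),
     (1, 0), (2, 1), (3, 0), (4, 3), (5, 0), (6, 5), (7, 2), (8, 7), (9, 2), (10, 9)}"
proof -
  have conv: "(insert (a, b) r)\<inverse> = insert (b, a) (r\<inverse>)" for a b :: 'b and r by auto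
  show "parcs extremal_tree = {(0, 1), (1, 2), (0, 3), (3, 4), (0, 5), (5, 6), (2, 7), (7, 8), (2, 9), (9, 10),
     (1, 0), (2, 1), (3, 0), (4, 3), (5, 0), (6, 5), (7, 2), (8, 7), (9, 2), (10, 9)}"
    by (simp only: extremal_tree_def Let_def pair_pre_digraph.simps conv converse_empty
      Un_insert_left Un_empty_left)
qed (simp add: extremal_tree_def Let_def)

text \<open>
  An isomorphism of digraphs carries its own head and tail maps, and the image must equal the target as
  a record; for pair graphs this makes these maps the two projections.
\<close>

lemma digraph_iso_with_projI:
  assumes "pair_wf_digraph G" and bij: "bij_betw h (pverts G) (pverts H)" 
    and arcs: "parcs H = map_prod h h ` parcs G"
  shows "digraph_iso (with_proj G) (with_proj H)"
proof -
  interpret pair_wf_digraph G by (rule assms(1))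
  let ?f = "\<lparr> iso_verts = h, iso_arcs = map_prod h h, iso_head = snd, iso_tail = fst \<rparr>"
  have inj: "inj_on h (pverts G)" using bij by (rule bij_betw_imp_inj_on)
  have "inj_on (map_prod h h) (parcs G)"
    using inj in_arcsD1 in_arcsD2 by (auto simp: inj_on_def)
  then have "pre_digraph.digraph_isomorphism (with_proj G) ?f"
    using inj wf_digraph unfolding pre_digraph.digraph_isomorphism_def by auto
  moreover have "with_proj H = app_iso ?f (with_proj G)"
    using bij arcs by (simp add: with_proj_def app_iso_def bij_betw_def)
  ultimately show ?thesis unfolding digraph_iso_def by blast
qed

lemma digraph_iso_with_projE:
  assumes "digraph_iso (with_proj G) (with_proj H)"
  obtains h where "bij_betw h (pverts G) (pverts H)" "parcs H = map_prod h h ` parcs G"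
proof -
  obtain f where f: "pre_digraph.digraph_isomorphism (with_proj G) f"
    and H: "with_proj H = app_iso f (with_proj G)" using assms by (auto simp: digraph_iso_def)
  note fp = f[unfolded pre_digraph.digraph_isomorphism_def with_proj_simps]
  have pv: "pverts H = iso_verts f ` pverts G" and pa: "parcs H = iso_arcs f ` parcs G"
    and "iso_tail f = fst" "iso_head f = snd"
    using arg_cong[OF H, of verts] arg_cong[OF H, of arcs] arg_cong[OF H, of tail] arg_cong[OF H, of head]
    by simp_all
  moreover from this have "iso_arcs f a = map_prod (iso_verts f) (iso_verts f) a" if "a \<in> parcs G" for a
    using fp that by (intro prod_eqI) auto
  ultimately have "parcs H = map_prod (iso_verts f) (iso_verts f) ` parcs G" by (simp cong: image_cong)
  then show ?thesis using that[of "iso_verts f"] pv fp by (simp add: bij_betw_def)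
qed

lemma extremal_tree_multiplicity:
  assumes iso: "digraph_iso (with_proj G) (with_proj extremal_tree)" and "pair_wf_digraph G"
    and vs: "distinct vs" "set vs = pverts G"
  shows "1 \<le> eigenvalue_multiplicity (laplacian_mat vs G) 1"
proof -
  interpret pair_wf_digraph G by (rule assms(2))
  obtain h where h: "bij_betw h (pverts G) (pverts extremal_tree)" 
    and arcs: "parcs extremal_tree = map_prod h h ` parcs G" using digraph_iso_with_projE[OF iso] .
  have inj: "inj_on h (pverts G)" using h by (rule bij_betw_imp_inj_on)
  \<comment> \<open>Up to scaling, the only eigenvector: \<open>1, 2, 1\<close> along the path \<open>u, w, v\<close>, continued by \<open>0\<close> and \<open>-1\<close>
    on the copies of \<open>P\<^sub>2\<close>.\<close>
  let ?g = "\<lambda>i::nat. (if i = 1 then 2 else if i \<in> {0, 2} then 1 else if i \<in> {3, 5, 7, 9} then 0 else -1 :: real)"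
  have g: "real (card (parcs extremal_tree `` {i})) * ?g i - (\<Sum>u\<in>parcs extremal_tree `` {i}. ?g u) = ?g i"
    if i: "i \<in> {0..10}" for i
  proof -
    have image: "insert (a, b) r `` {x} = (if a = x then insert b (r `` {x}) else r `` {x})"
      for a b x :: nat and r by auto
    have N: "parcs extremal_tree `` {0} = {1, 3, 5}" "parcs extremal_tree `` {1} = {2, 0}"
      "parcs extremal_tree `` {2} = {7, 9, 1}" "parcs extremal_tree `` {3} = {4, 0}"
      "parcs extremal_tree `` {4} = {3}" "parcs extremal_tree `` {5} = {6, 0}" 
      "parcs extremal_tree `` {6} = {5}" "parcs extremal_tree `` {7} = {8, 2}" 
      "parcs extremal_tree `` {8} = {7}" "parcs extremal_tree `` {9} = {10, 2}" 
      "parcs extremal_tree `` {10} = {9}"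
      unfolding extremal_tree_simps by (simp_all add: image)
    have "i = 0 \<or> i = 1 \<or> i = 2 \<or> i = 3 \<or> i = 4 \<or> i = 5 \<or> i = 6 \<or> i = 7 \<or> i = 8 \<or> i = 9 \<or> i = 10"
      using i unfolding atLeastAtMost_iff by presburger
    then show ?thesis by (elim disjE; simp only: N) simp_all
  qed
  show ?thesis
  proof (rule laplacian_multiplicity_pos[OF vs(1), where f = "?g \<circ> h"])
    show "parcs G \<subseteq> set vs \<times> set vs" using vs(2) in_arcsD1 in_arcsD2 by auto
    fix y assume "y \<in> set vs"
    then have y: "y \<in> pverts G" using vs by simp
    have N: "parcs extremal_tree `` {h y} = h ` (parcs G `` {y})"
    proof (intro equalityI subsetI)
      fix b assume "b \<in> parcs extremal_tree `` {h y}"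
      then obtain a c where ac: "(a, c) \<in> parcs G" "h a = h y" "b = h c" unfolding arcs by auto
      then have "a = y" using inj_onD[OF inj _ in_arcsD1[OF ac(1)] y] by simp
      then show "b \<in> h ` (parcs G `` {y})" using ac by auto
    qed (auto simp: arcs)
    have injN: "inj_on h (parcs G `` {y})"
      by (rule inj_on_subset[OF inj]) (auto dest: in_arcsD2)
    have "h y \<in> {0..10}" using bij_betwE[OF h] y by (auto simp: extremal_tree_simps(1))
    from g[OF this] show "real (card (parcs G `` {y})) * (?g \<circ> h) y - (\<Sum>u\<in>parcs G `` {y}. (?g \<circ> h) u) = 1 * (?g \<circ> h) y"
      unfolding N card_image[OF injN] sum.reindex[OF injN] by (simp only: comp_def mult_1)
  next
    have "0 \<in> h ` pverts G" using h by (auto simp: bij_betw_def extremal_tree_simps(1))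
    then obtain x where x: "x \<in> pverts G" "h x = 0" by auto
    show "inv_into (pverts G) h 0 \<in> set vs" using \<open>0 \<in> _\<close> vs by (simp add: inv_into_into)
    show "(?g \<circ> h) (inv_into (pverts G) h 0) \<noteq> 0" using \<open>0 \<in> _\<close> by (simp add: f_inv_into_f)
  qed
qed

lemma (in short_arm_tree) extremal_iso:
  assumes ext: "extremal v c c'" and T: "V = pverts T" "E = parcs T" "pair_wf_digraph T"
  shows "digraph_iso (with_proj T) (with_proj extremal_tree)"
proof -
  obtain q1 l1 q2 l2 q3 l3 q4 l4 where
    V: "V = {c, v, c', q1, l1, q2, l2, q3, l3, q4, l4}" and
    dist: "distinct [c, v, c', q1, l1, q2, l2, q3, l3, q4, l4]" and
    N: "nbrs c = {v, q1, q2}" "nbrs v = {c, c'}" "nbrs c' = {v, q3, q4}"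
    "nbrs q1 = {c, l1}" "nbrs l1 = {q1}" "nbrs q2 = {c, l2}" "nbrs l2 = {q2}"
    "nbrs q3 = {c', l3}" "nbrs l3 = {q3}" "nbrs q4 = {c', l4}" "nbrs l4 = {q4}"
    by (rule extremal_layout[OF ext])
  define xs where "xs = [c, v, c', q1, l1, q2, l2, q3, l3, q4, l4]"
  have xs: "distinct xs" "set xs = V" "length xs = 11" using V dist by (auto simp: xs_def)
  define h where "h = the_inv_into {..<11} ((!) xs)"
  have bij: "bij_betw ((!) xs) {..<11} V" using xs by (intro bij_betw_nth) auto
  have hx: "h (xs ! i) = i" if "i < 11" for i
    unfolding h_def using that bij by (intro the_inv_into_f_f) (auto simp: bij_betw_def)
  have hs: "h c = 0" "h v = 1" "h c' = 2" "h q1 = 3" "h l1 = 4" "h q2 = 5" "h l2 = 6" "h q3 = 7"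
    "h l3 = 8" "h q4 = 9" "h l4 = 10"
    using hx[of 0] hx[of 1] hx[of 2] hx[of 3] hx[of 4] hx[of 5] hx[of 6] hx[of 7] hx[of 8] hx[of 9] hx[of 10]
    by (simp_all add: xs_def)
  have "bij_betw h V {..<11}" unfolding h_def by (rule bij_betw_the_inv_into[OF bij])
  moreover have "{..<11} = {0..10::nat}" by auto
  ultimately have hbij: "bij_betw h (pverts T) (pverts extremal_tree)" by (simp add: T extremal_tree_simps(1))
  have "E = (\<Union>x\<in>V. Pair x ` nbrs x)" using E_sub by auto
  also have "\<dots> = {(c, v), (c, q1), (c, q2), (v, c), (v, c'), (c', v), (c', q3), (c', q4), (q1, c), (q1, l1),
      (l1, q1), (q2, c), (q2, l2), (l2, q2), (q3, c'), (q3, l3), (l3, q3), (q4, c'), (q4, l4), (l4, q4)}"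
    by (simp only: V N Union_insert Union_empty image_insert image_empty Un_insert_left Un_empty_left Un_empty_right)
  finally have "parcs extremal_tree = map_prod h h ` E"
    unfolding extremal_tree_simps(2) by (simp only: image_insert image_empty map_prod_simp hs) (rule equalityI; simp)
  then show ?thesis using digraph_iso_with_projI[OF T(3) hbij] T(2) by simp
qed

section \<open>The bound and the case of equality\<close>

theorem theorem1p1:
  fixes T :: "'a pair_pre_digraph" and vs :: "'a list" and n m :: nat
  assumes "tree_graph T"
    and "reduced T"
    and "n = card (pverts T)" and "n \<ge> 7"
    and "\<not> contains_pendant_path T 3"
    and "\<forall>v \<in> quasi_pendant_verts T. degree_of T v = 2"
    and "distinct vs" and "set vs = pverts T"
    and "m = eigenvalue_multiplicity (laplacian_mat vs T) 1"
  shows "real m \<le> (real n - 5) / 6 \<and>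
         (real m = (real n - 5) / 6 \<longleftrightarrow>
            digraph_iso (with_proj T) (with_proj extremal_tree))"
proof -
  let ?P = "pendant_verts T" and ?Q = "quasi_pendant_verts T"
  interpret short_arm_tree "pverts T" "parcs T" ?P ?Q "pverts T - ?P - ?Q"
    by (rule short_arm_tree_of_tree_graph[OF assms(1,5,6)])
  have wf: "pair_wf_digraph T" by unfold_locales (auto dest: edge_in_V)
  have "pverts T - ?P - ?Q \<noteq> {}" using R_nonempty assms(3,4) by simp
  then obtain Y where Y: "Y \<subseteq> pverts T" "6 * card Y + 5 \<le> n"
    "n = 6 * card Y + 5 \<Longrightarrow> \<exists>v c c'. extremal v c c'"
    "\<And>f x. (\<And>y. y \<in> pverts T \<Longrightarrow> eig f y) \<Longrightarrow> (\<And>z. z \<in> Y \<Longrightarrow> f z = 0) \<Longrightarrow> x \<in> pverts T \<Longrightarrow> f x = 0"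
    unfolding assms(3) by (rule determining_set) (use assms(3,4) in auto)
  have "m \<le> card Y"
    unfolding assms(9)
  proof (rule laplacian_multiplicity_le[OF assms(7) _ sym_E])
    show "parcs T \<subseteq> set vs \<times> set vs" using E_sub assms(8) by simp
    show "Y \<subseteq> set vs" using Y(1) assms(8) by simp
    show "f x = 0"
      if ev: "\<And>y. y \<in> set vs \<Longrightarrow> real (card (nbrs y)) * f y - (\<Sum>u\<in>nbrs y. f u) = 1 * f y"
        and zero: "\<And>y. y \<in> Y \<Longrightarrow> f y = 0" and x: "x \<in> set vs" for f x
    proof (rule Y(4)[OF _ zero])
      show "eig f y" if "y \<in> pverts T" for y
        using ev[of y] that assms(8) by (simp add: eig_def)
      show "x \<in> pverts T" using x assms(8) by simp
    qed
  qed
  then have le: "6 * m + 5 \<le> n" using Y(2) by linarith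
  have "real m = (real n - 5) / 6 \<longleftrightarrow> n = 6 * m + 5" by (simp add: field_simps) linarith
  also have "\<dots> \<longleftrightarrow> digraph_iso (with_proj T) (with_proj extremal_tree)"
  proof
    assume "n = 6 * m + 5"
    then have "n = 6 * card Y + 5" using \<open>m \<le> card Y\<close> Y(2) by linarith
    then show "digraph_iso (with_proj T) (with_proj extremal_tree)"
      using Y(3) extremal_iso[OF _ refl refl wf] by blast
  next
    assume iso: "digraph_iso (with_proj T) (with_proj extremal_tree)"
    have "card (pverts T) = card (pverts extremal_tree)"
      using digraph_iso_with_projE[OF iso] by (metis bij_betw_same_card)
    then have "n = 11" by (simp add: assms(3) extremal_tree_simps(1))
    moreover have "1 \<le> m"
      unfolding assms(9) by (rule extremal_tree_multiplicity[OF iso wf assms(7,8)])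
    ultimately show "n = 6 * m + 5" using le by linarith
  qed
  finally show ?thesis using le by (simp add: field_simps)
qed

end
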